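(* Let $\nu\ge-\tfrac14$ and $x\in\mathbb{C}\setminus(-\infty,0]$. Then $$\int_0^\infty a^2\,J_{2\nu}(ax)\,J_{\nu+1/2}(a^2)\,da=\frac{x}{4}\,J_{\nu-1/2}\left(\frac{x^2}{4}\right).$$
   Context: $J_\nu$ is the Bessel function of the first kind of order $\nu$.
   Formalization: For non-real x the integral diverges (e.g. ν=0, x=i); there it is read as the limit ε→0+ of integrals with factor exp(-εa²). For Re x≤0 the right side is the analytic continuation from x>0, not always the principal branch. For x>0 the formula is proved literally. *)

theory Defs
  imports "HOL-Analysis.Analysis"
begin

definition bessel_series :: "real \<Rightarrow> complex \<Rightarrow> complex" where
  "bessel_series \<nu> z =
     (\<Sum>k. (- 1) ^ k * rGamma (of_real \<nu> + of_nat k + 1) / fact k * (z / 2) ^ (2 * k))"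

text \<open>
  The Bessel function of the first kind, principal branch. Since \<open>0 powr 0 = 0\<close> in the
  library, order \<open>0\<close> is treated separately so that it takes the value \<open>1\<close> at the origin.
\<close>
definition bessel_J :: "real \<Rightarrow> complex \<Rightarrow> complex" where
  "bessel_J \<nu> z = (if \<nu> = 0 then 1 else (z / 2) powr of_real \<nu>) * bessel_series \<nu> z"

text \<open>
  The same function on the Riemann surface of the logarithm: \<open>bessel_J_log \<nu> w\<close> is the value
  at the point lying over \<open>exp w\<close> whose logarithm is \<open>w\<close>. It is entire in \<open>w\<close>.
\<close>
definition bessel_J_log :: "real \<Rightarrow> complex \<Rightarrow> complex" where
  "bessel_J_log \<nu> w = exp (of_real \<nu> * (w - of_real (ln 2))) * bessel_series \<nu> (exp w)"

lemma bessel_J_log_Ln: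
  assumes "z \<noteq> 0"
  shows "bessel_J_log \<nu> (Ln z) = bessel_J \<nu> z"
proof -
  have "Ln (z / of_real 2) = Ln z - of_real (ln 2)"
    using assms by (subst Ln_divide_of_real) auto
  then show ?thesis
    using assms by (auto simp: bessel_J_log_def bessel_J_def powr_def)
qed

lemma bessel_J_log_square:
  assumes "Re x > 0"
  shows "bessel_J_log \<nu> (2 * Ln (x / 2)) = bessel_J \<nu> (x\<^sup>2 / 4)"
proof -
  have nz: "x \<noteq> 0" using assms by auto
  have "\<bar>Im (Ln (x / 2))\<bar> < pi / 2"
    using assms nz by (subst Re_Ln_pos_lt) auto
  then have "Ln (exp (2 * Ln (x / 2))) = 2 * Ln (x / 2)"
    by (intro Ln_exp) auto
  moreover have "exp (2 * Ln (x / 2)) = x\<^sup>2 / 4"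
    using nz by (simp add: exp_double power_divide)
  ultimately show ?thesis
    using bessel_J_log_Ln[of "x\<^sup>2 / 4" \<nu>] nz by simp
qed

text \<open>
  Abel (Gaussian) summability of \<open>\<integral>\<^sub>0\<^sup>\<infinity> f(a) da\<close> to the value \<open>I\<close>. It gives a meaning to
  oscillatory integrals whose integrand grows exponentially in \<open>a\<close>, such as those with
  a factor \<open>bessel_J \<nu> (a x)\<close> for non-real \<open>x\<close>.
\<close>
definition has_abel_integral :: "(real \<Rightarrow> complex) \<Rightarrow> complex \<Rightarrow> bool" where
  "has_abel_integral f I \<longleftrightarrow>
     (\<forall>\<epsilon>>0. (\<lambda>a. exp (- \<epsilon> * a\<^sup>2) *\<^sub>R f a) absolutely_integrable_on {0..}) \<and>
     ((\<lambda>\<epsilon>. integral {0..} (\<lambda>a. exp (- \<epsilon> * a\<^sup>2) *\<^sub>R f a)) \<longlongrightarrow> I) (at_right 0)"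

definition bessel_integrand :: "real \<Rightarrow> complex \<Rightarrow> real \<Rightarrow> complex" where
  "bessel_integrand \<nu> x a =
     of_real (a\<^sup>2) * bessel_J (2 * \<nu>) (of_real a * x) * bessel_J (\<nu> + 1 / 2) (of_real (a\<^sup>2))"

end

theory Submission
  imports Defs "HOL-Complex_Analysis.Complex_Analysis"
begin

text \<open>
  Expand \<open>J\<^sub>2\<^sub>\<nu>(ax)\<close> in powers of \<open>x\<close>. With the weight \<open>exp (- \<epsilon> a\<^sup>2)\<close> and \<open>\<mu> = \<nu> + 1/2\<close>, the
  \<open>k\<close>-th term leads to the integral of \<open>exp (- \<epsilon> a\<^sup>2) a\<^sup>2\<^sup>\<mu>\<^sup>+\<^sup>1\<^sup>+\<^sup>2\<^sup>k J\<^sub>\<mu>(a\<^sup>2)\<close>, which is the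
  \<open>k\<close>-th derivative (up to sign) of its value for \<open>k = 0\<close>, namely a constant times
  \<open>(1 + \<epsilon>\<^sup>2) powr - (\<mu> + 1/2)\<close>; this is computed termwise for \<open>\<epsilon> > 1\<close> and continued
  analytically to \<open>Re \<epsilon> > 0\<close>. As \<open>\<epsilon>\<close> tends to \<open>0\<close>, Cauchy's estimates on the unit disc dominate
  the sum, the odd terms vanish, and the duplication formula identifies the limit.
  For real \<open>x > 0\<close> two integrations by parts and the decay \<open>J\<^sub>\<nu>(t) = O(t\<^sup>-\<^sup>1\<^sup>/\<^sup>2)\<close> show that the
  integral converges, and Abel's theorem (through the second mean value theorem) identifies its value.
\<close>

subsection \<open>Bessel functions of a positive real argument\<close>

text \<open>For non-real x the factor J_{2\<nu>}(ax) grows like exp(a |Im x|), so only a summed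
  value can be asserted. Even for real x the expansion cannot be integrated term by term without a
  weight: from k = 1 on at the latest, a^(2\<mu>+1+2k) J_\<mu>(a^2) has a divergent integral. The
  Gaussian is chosen because in t = a^2 it is the Laplace kernel exp(-\<epsilon> t) and the Bessel
  factor is J_\<mu>(t), so an extra a^(2k) becomes k derivatives in \<epsilon>. The transform is
  singular only at i and -i, hence regular at 0 although the unweighted integrals diverge. Near 0
  its k-th derivative is at most M 2^k k!, while the coefficients of J_{2\<nu>} carry 1 / (k!
  Gamma(2\<nu>+k+1)): one factor absorbs k!, the other leaves a series converging for every x. The
  limit contains (x/2)^(2\<nu>) with the branch of Ln (x/2); agreement with the principal value of J
  at x^2/4 is guaranteed for Re x > 0, and in general the value is expressed through 2 Ln
  (x/2).\<close>

definition bessel_coeff :: "real \<Rightarrow> nat \<Rightarrow> real" where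
  "bessel_coeff \<nu> k = (- 1) ^ k * rGamma (\<nu> + real k + 1) / fact k"

text \<open>In terms of the Bessel-Clifford function C_\<nu> this is C_\<nu>(-y). Splitting off
  (t/2)^\<nu> leaves a function entire in y = t^2/4, and \<open>rGamma\<close>, zero at the poles of
  Gamma, gives it a meaning for every real order.\<close>

definition bessel_core :: "real \<Rightarrow> real \<Rightarrow> real" where
  "bessel_core \<nu> y = (\<Sum>k. bessel_coeff \<nu> k * y ^ k)"

text \<open>For \<nu> = 0 the value at t = 0 is 0 and not 1, because \<open>0 powr 0 = 0\<close>;
  agreement with \<open>bessel_J\<close> is therefore claimed for t > 0 only.\<close>

definition real_J :: "real \<Rightarrow> real \<Rightarrow> real" where
  "real_J \<nu> t = (t / 2) powr \<nu> * bessel_core \<nu> (t\<^sup>2 / 4)"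

text \<open>A consequence of rGamma z = z rGamma (z + 1), kept free of division because \<nu> + k +
  1 may be 0.\<close>

lemma bessel_coeff_Suc:
  "bessel_coeff \<nu> (Suc k) * (real (Suc k) * (\<nu> + real k + 1)) = - bessel_coeff \<nu> k"
proof -
  define g where "g = rGamma (\<nu> + real k + 1 + 1)"
  have "bessel_coeff \<nu> (Suc k) = - ((- 1) ^ k * g) / (real (Suc k) * fact k)"
    by (simp add: bessel_coeff_def g_def add_ac)
  moreover have "bessel_coeff \<nu> k = (- 1) ^ k * ((\<nu> + real k + 1) * g) / fact k"
    unfolding bessel_coeff_def g_def rGamma_plus1 ..
  ultimately show ?thesis
    by (simp del: of_nat_Suc)
qed

text \<open>On coefficients, differentiation in y raises the order by one and changes the
  sign.\<close>

lemma bessel_coeff_shift: "real (Suc k) * bessel_coeff \<nu> (Suc k) = - bessel_coeff (\<nu> + 1) k"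
proof -
  define g where "g = rGamma (\<nu> + 1 + real k + 1)"
  have "bessel_coeff \<nu> (Suc k) = - ((- 1) ^ k * g) / (real (Suc k) * fact k)"
    by (simp add: bessel_coeff_def g_def add_ac)
  moreover have "bessel_coeff (\<nu> + 1) k = (- 1) ^ k * g / fact k"
    unfolding bessel_coeff_def g_def ..
  ultimately show ?thesis
    by (simp del: of_nat_Suc)
qed

lemma bessel_coeff_down: "(\<nu> + real k + 1) * bessel_coeff (\<nu> + 1) k = bessel_coeff \<nu> k"
proof -
  have "(\<nu> + real k + 1) * (real (Suc k) * bessel_coeff \<nu> (Suc k)) = - bessel_coeff \<nu> k"
    unfolding bessel_coeff_Suc [symmetric] by (simp only: mult_ac)
  then show ?thesis
    unfolding bessel_coeff_shift by simp
qed

lemma summable_bessel_core: "summable (\<lambda>k. bessel_coeff \<nu> k * y ^ k)"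
proof (rule summable_ratio_test)
  fix k :: nat
  \<comment> \<open>From this index on, k + 1 \<ge> 2 |y| and \<nu> + k + 1 \<ge> 1, so each term is
    at most half of its predecessor.\<close>
  assume k: "k \<ge> nat \<lceil>\<bar>\<nu>\<bar> + 2 * \<bar>y\<bar>\<rceil>"
  then have k: "real k \<ge> \<bar>\<nu>\<bar> + 2 * \<bar>y\<bar>" by linarith
  define p where "p = real (Suc k) * (\<nu> + real k + 1)"
  have "(2 * \<bar>y\<bar>) * 1 \<le> p"
    unfolding p_def using k by (intro mult_mono) auto
  then have p: "2 * \<bar>y\<bar> \<le> \<bar>p\<bar>" by linarith
  have "norm (bessel_coeff \<nu> (Suc k) * y ^ Suc k) * 2
      = \<bar>bessel_coeff \<nu> (Suc k)\<bar> * \<bar>y\<bar> ^ k * (2 * \<bar>y\<bar>)"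
    by (simp add: abs_mult power_abs)
  also have "\<dots> \<le> \<bar>bessel_coeff \<nu> (Suc k)\<bar> * \<bar>y\<bar> ^ k * \<bar>p\<bar>"
    using p by (intro mult_left_mono) auto
  also have "\<dots> = \<bar>bessel_coeff \<nu> (Suc k) * p\<bar> * \<bar>y\<bar> ^ k"
    by (simp add: abs_mult)
  also have "\<dots> = norm (bessel_coeff \<nu> k * y ^ k)"
    unfolding p_def bessel_coeff_Suc by (simp add: abs_mult power_abs)
  finally show "norm (bessel_coeff \<nu> (Suc k) * y ^ Suc k) \<le> 1 / 2 * norm (bessel_coeff \<nu> k * y ^ k)"
    by simp
qed simp

lemma summable_abs_bessel_core: "summable (\<lambda>k. \<bar>bessel_coeff \<nu> k\<bar> * \<bar>y\<bar> ^ k)"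
  using powser_insidea[OF summable_bessel_core[of \<nu> "\<bar>y\<bar> + 1"], of "\<bar>y\<bar>"]
  by (simp add: abs_mult)

lemma has_field_derivative_bessel_core:
  "(bessel_core \<nu> has_field_derivative - bessel_core (\<nu> + 1) y) (at y)"
proof -
  have "diffs (bessel_coeff \<nu>) = (\<lambda>k. - bessel_coeff (\<nu> + 1) k)"
    unfolding diffs_def bessel_coeff_shift ..
  moreover have "(\<Sum>k. - (bessel_coeff (\<nu> + 1) k * y ^ k)) = - bessel_core (\<nu> + 1) y"
    unfolding bessel_core_def by (rule suminf_minus[OF summable_bessel_core])
  ultimately show ?thesis
    using termdiffs_strong_converges_everywhere[of "bessel_coeff \<nu>" y, OF summable_bessel_core]
    by (simp add: bessel_core_def [abs_def])
qed

text \<open>The coefficient of order \<nu> is \<nu> + 1 + k times that of order \<nu> + 1. The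
  factor k acts as y d/dy, which sends the core of order \<nu> + 1 to -y times the core of order
  \<nu> + 2.\<close>

lemma bessel_core_recurrence:
  "bessel_core \<nu> y = (\<nu> + 1) * bessel_core (\<nu> + 1) y - y * bessel_core (\<nu> + 2) y"
proof -
  define c where "c = bessel_coeff (\<nu> + 1)"
  have s: "summable (\<lambda>k. c k * y ^ k)"
    unfolding c_def by (rule summable_bessel_core)
  have t: "(\<lambda>k. real k * c k * y ^ k) sums (- y * bessel_core (\<nu> + 2) y)"
  proof -
    have "real (Suc k) * c (Suc k) * y ^ Suc k = - y * (bessel_coeff (\<nu> + 2) k * y ^ k)" for k
      unfolding c_def bessel_coeff_shift by (simp add: add.assoc)
    moreover have "(\<lambda>k. - y * (bessel_coeff (\<nu> + 2) k * y ^ k)) sums (- y * bessel_core (\<nu> + 2) y)"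
      unfolding bessel_core_def by (intro sums_mult summable_sums summable_bessel_core)
    ultimately have "(\<lambda>k. real (Suc k) * c (Suc k) * y ^ Suc k) sums (- y * bessel_core (\<nu> + 2) y)"
      by presburger
    then show ?thesis
      using sums_Suc_iff [of "\<lambda>k. real k * c k * y ^ k"] by simp
  qed
  have "(\<lambda>k. (\<nu> + 1) * (c k * y ^ k) + real k * c k * y ^ k) sums
      ((\<nu> + 1) * bessel_core (\<nu> + 1) y + - y * bessel_core (\<nu> + 2) y)"
    using summable_sums[OF s] t unfolding c_def bessel_core_def by (intro sums_add sums_mult)
  moreover have "(\<nu> + 1) * (c k * y ^ k) + real k * c k * y ^ k = bessel_coeff \<nu> k * y ^ k" for k
    unfolding c_def bessel_coeff_down [of \<nu> k, symmetric] by (simp add: algebra_simps)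
  ultimately show ?thesis
    unfolding bessel_core_def by (simp add: sums_iff)
qed

lemma has_field_derivative_real_J:
  assumes "t > 0"
  shows "(real_J \<nu> has_field_derivative (\<nu> / t * real_J \<nu> t - real_J (\<nu> + 1) t)) (at t)"
proof -
  have "((\<lambda>t. t\<^sup>2 / 4) has_field_derivative t / 2) (at t)"
    by (auto intro!: derivative_eq_intros)
  from DERIV_chain2[OF has_field_derivative_bessel_core this, of \<nu>]
  have core: "((\<lambda>t. bessel_core \<nu> (t\<^sup>2 / 4)) has_field_derivative
      - bessel_core (\<nu> + 1) (t\<^sup>2 / 4) * (t / 2)) (at t)" .
  have "((\<lambda>t. t / 2) has_field_derivative 1 / 2) (at t)"
    by (auto intro!: derivative_eq_intros)
  from DERIV_chain2[OF has_real_derivative_powr[of "t / 2" \<nu>] this]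
  have pow: "((\<lambda>t. (t / 2) powr \<nu>) has_field_derivative
      \<nu> * (t / 2) powr (\<nu> - 1) * (1 / 2)) (at t)"
    using assms by simp
  have p: "(t / 2) powr (\<nu> + 1) = (t / 2) powr \<nu> * (t / 2)"
    using assms by (simp add: powr_add)
  have p': "(t / 2) powr (\<nu> - 1) = (t / 2) powr \<nu> / (t / 2)"
    using assms by (simp add: powr_diff)
  show ?thesis
    unfolding real_J_def [abs_def]
    by (rule DERIV_cong[OF DERIV_mult[OF pow core]]) (use assms in \<open>simp only: p p'\<close>, simp add: field_simps)
qed

lemma real_J_recurrence:
  assumes "t > 0"
  shows "real_J \<nu> t = 2 * (\<nu> + 1) / t * real_J (\<nu> + 1) t - real_J (\<nu> + 2) t"
proof -
  have p: "(t / 2) powr (\<nu> + 1) = (t / 2) powr \<nu> * (t / 2)"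
       "(t / 2) powr (\<nu> + 2) = (t / 2) powr \<nu> * (t / 2)\<^sup>2"
    using assms by (simp_all add: powr_add powr_numeral)
  show ?thesis
    unfolding real_J_def p bessel_core_recurrence[of \<nu> "t\<^sup>2 / 4"]
    using assms by (simp add: field_simps power2_eq_square)
qed

text \<open>Together with \<open>has_field_derivative_real_J\<close> this gives a closed first-order
  linear system for J_\<nu> and J_{\<nu>+1}, the form in which the energy is differentiated.\<close>

lemma has_field_derivative_real_J_Suc:
  assumes "t > 0"
  shows "(real_J (\<nu> + 1) has_field_derivative (real_J \<nu> t - (\<nu> + 1) / t * real_J (\<nu> + 1) t)) (at t)"
proof -
  have "(\<nu> + 1) / t * real_J (\<nu> + 1) t - real_J (\<nu> + 1 + 1) t
      = real_J \<nu> t - (\<nu> + 1) / t * real_J (\<nu> + 1) t"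
    using real_J_recurrence[OF assms, of \<nu>] assms by (simp add: add.assoc field_simps)
  then show ?thesis
    using has_field_derivative_real_J[OF assms, of "\<nu> + 1"] by metis
qed

lemma continuous_on_real_J: "continuous_on {0<..} (real_J \<nu>)"
  by (meson DERIV_isCont continuous_at_imp_continuous_on greaterThan_iff has_field_derivative_real_J)

text \<open>
  The energy \<open>E = t (J\<^sub>\<nu>\<^sup>2 + J\<^sub>\<nu>\<^sub>+\<^sub>1\<^sup>2) - (2\<nu> + 1) J\<^sub>\<nu> J\<^sub>\<nu>\<^sub>+\<^sub>1\<close> has derivative \<open>(2\<nu> + 1) J\<^sub>\<nu> J\<^sub>\<nu>\<^sub>+\<^sub>1 / t\<close>,
  which is \<open>O(E / t\<^sup>2)\<close>; hence \<open>E\<close> is bounded.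
\<close>
lemma real_J_decay: "\<exists>C. \<forall>t\<ge>1. \<bar>real_J \<nu> t\<bar> \<le> C / sqrt t"
proof -
  define c where "c = \<nu> + 1 / 2"
  define j where "j = real_J \<nu>"
  define j1 where "j1 = real_J (\<nu> + 1)"
  have dj: "(j has_field_derivative (\<nu> / t * j t - j1 t)) (at t)"
    and dj1: "(j1 has_field_derivative (j t - (\<nu> + 1) / t * j1 t)) (at t)" if "t > 0" for t
    unfolding j_def j1_def
    using has_field_derivative_real_J[OF that] has_field_derivative_real_J_Suc[OF that] by auto
  have cj: "continuous_on {0<..} j"
    unfolding j_def by (rule continuous_on_real_J)
  \<comment> \<open>Beyond T the mixed term of the energy is at most |c| S \<le> (t/4) S, so E keeps
    at least three quarters of t S.\<close>
  define T where "T = 1 + 4 * \<bar>c\<bar>"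
  define S where "S t = (j t)\<^sup>2 + (j1 t)\<^sup>2" for t
  define E where "E t = t * S t - 2 * c * (j t * j1 t)" for t
  \<comment> \<open>The exponential is an integrating factor: E' \<le> 2 |c| E / t^2 for t \<ge> T,
    and exp (2 |c| / t) contributes exactly the opposite term, so H is nonincreasing.\<close>
  define H where "H t = E t * exp (2 * \<bar>c\<bar> / t)" for t
  have T: "T \<ge> 1" unfolding T_def by simp
  have prod: "\<bar>j t * j1 t\<bar> * 2 \<le> S t" for t
    using sum_squares_bound[of "\<bar>j t\<bar>" "\<bar>j1 t\<bar>"] by (simp add: S_def abs_mult)
  have bnd: "2 * c * p \<le> \<bar>c\<bar> * (\<bar>p\<bar> * 2)" for p :: real
    using abs_ge_self[of "2 * c * p"] by (simp add: abs_mult)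
  have S0: "S t \<ge> 0" for t by (simp add: S_def)
  have ES: "E t \<ge> 3 / 4 * (t * S t)" if "t \<ge> T" for t
  proof -
    have "2 * c * (j t * j1 t) \<le> \<bar>c\<bar> * (\<bar>j t * j1 t\<bar> * 2)"
      by (rule bnd)
    also have "\<dots> \<le> \<bar>c\<bar> * S t"
      by (intro mult_left_mono prod) auto
    also have "\<dots> \<le> (t / 4) * S t"
      using that S0 by (intro mult_right_mono) (auto simp: T_def)
    finally show ?thesis by (simp add: E_def)
  qed
  have dE: "(E has_field_derivative 2 * c * (j t * j1 t) / t) (at t)" if "t > 0" for t
    unfolding E_def [abs_def] S_def [abs_def]
    apply (rule derivative_eq_intros dj[OF that] dj1[OF that] refl)+
    using that by (simp add: c_def field_simps power2_eq_square)
  have H_le: "H t \<le> H T" if "t \<ge> T" for t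
  proof (rule DERIV_nonpos_imp_nonincreasing[OF that])
    fix s assume s: "T \<le> s" "s \<le> t"
    then have s0: "s > 0" using T by linarith
    define d where "d = (2 * c * (j s * j1 s) / s - 2 * \<bar>c\<bar> / s\<^sup>2 * E s) * exp (2 * \<bar>c\<bar> / s)"
    define K where "K = 2 * \<bar>c\<bar>"
    have "((\<lambda>t. exp (K / t)) has_field_derivative exp (K / s) * (- K / s\<^sup>2)) (at s)"
      using s0 by (auto intro!: derivative_eq_intros simp: power2_eq_square)
    from DERIV_mult[OF dE[OF s0] this] have "(H has_field_derivative d) (at s)"
      unfolding H_def [abs_def] d_def K_def [symmetric] by (simp add: algebra_simps)
    moreover have "d \<le> 0"
    proof -
      have "2 * c * (j s * j1 s) \<le> \<bar>c\<bar> * (\<bar>j s * j1 s\<bar> * 2)"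
        by (rule bnd)
      also have "\<dots> \<le> \<bar>c\<bar> * S s"
        by (intro mult_left_mono prod) auto
      also have "\<dots> \<le> \<bar>c\<bar> * (2 * E s / s)"
      proof (intro mult_left_mono)
        have "s * S s \<le> 2 * E s"
          using ES[OF s(1)] s0 S0[of s] mult_nonneg_nonneg[of s "S s"] by linarith
        then show "S s \<le> 2 * E s / s"
          using s0 by (simp add: field_simps)
      qed simp
      finally have "2 * c * (j s * j1 s) / s \<le> 2 * \<bar>c\<bar> / s\<^sup>2 * E s"
        using s0 by (simp add: field_simps power2_eq_square)
      then show ?thesis unfolding d_def by (simp add: mult_nonpos_nonneg)
    qed
    ultimately show "\<exists>y. DERIV H s :> y \<and> y \<le> 0" by blast
  qed
  have far: "\<bar>j t\<bar> * sqrt t \<le> sqrt (2 * H T)" if "t \<ge> T" for t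
  proof -
    have t0: "t > 0" using that T by linarith
    have "t * (j t)\<^sup>2 \<le> t * S t"
      using t0 by (simp add: S_def)
    also have "\<dots> \<le> 2 * E t" using ES[OF that] S0[of t] t0 mult_nonneg_nonneg[of t "S t"] by linarith
    also have "E t \<le> H t"
    proof -
      have "E t \<ge> 0"
        using ES[OF that] S0[of t] t0 mult_nonneg_nonneg[of t "S t"] by linarith
      then show ?thesis
        unfolding H_def using t0 mult_left_mono[of 1 "exp (2 * \<bar>c\<bar> / t)" "E t"] by simp
    qed
    also have "H t \<le> H T" by (rule H_le[OF that])
    finally have "t * (j t)\<^sup>2 \<le> 2 * H T" by simp
    then have "sqrt (t * (j t)\<^sup>2) \<le> sqrt (2 * H T)" by (rule real_sqrt_le_mono)
    then show ?thesis by (simp add: real_sqrt_mult mult.commute)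
  qed
  \<comment> \<open>The monotonicity argument starts only at T; the remaining compact interval is
    covered by continuity.\<close>
  have "bounded ((\<lambda>t. j t * sqrt t) ` {1..T})"
    by (intro compact_imp_bounded compact_continuous_image continuous_intros
        continuous_on_subset[OF cj]) auto
  then obtain B where B: "\<And>t. t \<in> {1..T} \<Longrightarrow> \<bar>j t * sqrt t\<bar> \<le> B"
    unfolding bounded_iff by fastforce
  have "\<bar>real_J \<nu> t\<bar> \<le> max B (sqrt (2 * H T)) / sqrt t" if "t \<ge> 1" for t
    using far[of t] B[of t] that by (cases "t \<le> T") (auto simp: field_simps abs_mult j_def)
  then show ?thesis by blast
qed

text \<open>Decay settles t \<ge> 1. Near 0 the core is bounded, and \<nu> \<ge> 0 keeps (t/2)^\<nu>
  at most 1.\<close>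

lemma real_J_bounded:
  assumes "\<nu> \<ge> 0"
  obtains C where "\<And>t. t > 0 \<Longrightarrow> \<bar>real_J \<nu> t\<bar> \<le> C"
proof -
  obtain C1 where C1: "\<And>t. t \<ge> 1 \<Longrightarrow> \<bar>real_J \<nu> t\<bar> \<le> C1 / sqrt t"
    using real_J_decay by blast
  have C1pos: "C1 \<ge> 0" using C1[of 1] by simp
  have "continuous_on {0..1} (bessel_core \<nu>)"
    by (meson DERIV_isCont continuous_at_imp_continuous_on has_field_derivative_bessel_core)
  then have "bounded (bessel_core \<nu> ` {0..1})"
    by (intro compact_imp_bounded compact_continuous_image) auto
  then obtain B where B: "\<And>y. y \<in> {0..1} \<Longrightarrow> \<bar>bessel_core \<nu> y\<bar> \<le> B"
    unfolding bounded_iff by fastforce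
  have "\<bar>real_J \<nu> t\<bar> \<le> max B C1" if t: "t > 0" for t
  proof (cases "t \<ge> 1")
    case True
    have "C1 / sqrt t \<le> C1" using True C1pos mult_left_mono[of 1 "sqrt t" C1] by (simp add: divide_le_eq)
    then show ?thesis using C1[OF True] by simp
  next
    case False
    have "t\<^sup>2 \<le> 1" using False t by (simp add: power_le_one)
    then have "\<bar>bessel_core \<nu> (t\<^sup>2 / 4)\<bar> \<le> B" by (intro B) auto
    moreover have "(t / 2) powr \<nu> \<le> 1" using False t assms by (intro powr_le1) auto
    ultimately have "(t / 2) powr \<nu> * \<bar>bessel_core \<nu> (t\<^sup>2 / 4)\<bar> \<le> 1 * B"
      by (intro mult_mono) auto
    then show ?thesis by (simp add: real_J_def abs_mult)
  qed
  then show ?thesis by (rule that)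
qed

subsection \<open>Gaussian moments\<close>

lemma has_integral_greaterThan_0_iff:
  fixes f :: "real \<Rightarrow> 'a::banach"
  shows "(f has_integral I) {0<..} \<longleftrightarrow> (f has_integral I) {0..}"
  by (rule has_integral_spike_set_eq; rule negligible_subset[OF negligible_sing[of 0]]) auto

lemma absolutely_integrable_greaterThan_0_iff:
  fixes f :: "real \<Rightarrow> 'a::euclidean_space"
  shows "f absolutely_integrable_on {0<..} \<longleftrightarrow> f absolutely_integrable_on {0..}"
  by (rule absolutely_integrable_spike_set_eq; rule negligible_subset[OF negligible_sing[of 0]]) auto

lemma absolutely_integrable_iff_lebesgue_on:
  assumes "S \<in> sets lebesgue"
  shows "f absolutely_integrable_on S \<longleftrightarrow> integrable (lebesgue_on S) f"
  using assms by (simp add: set_integrable_def integrable_restrict_space)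

text \<open>Substitute t = c a^2 in Euler's integral: the Jacobian 2 c a turns t^(r-1) into 2 c^r
  a^(2r-1).\<close>

lemma gaussian_gamma:
  fixes c r :: real
  assumes c: "c > 0" and r: "r > 0"
  shows "integrable (lebesgue_on {0<..}) (\<lambda>a. exp (- c * a\<^sup>2) * a powr (2 * r - 1))"
    and "(LINT a|lebesgue_on {0<..}. exp (- c * a\<^sup>2) * a powr (2 * r - 1)) = Gamma r / (2 * c powr r)"
proof -
  define f where "f t = t powr (r - 1) / exp t" for t :: real
  define g where "g a = c * a\<^sup>2" for a :: real
  have "(f has_integral Gamma r) {0..}"
    unfolding f_def [abs_def] by (rule Gamma_integral_real[OF r])
  then have hf: "(f has_integral Gamma r) {0<..}"
    by (simp add: has_integral_greaterThan_0_iff)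
  then have "f absolutely_integrable_on {0<..}"
    by (intro nonnegative_absolutely_integrable_1) (auto simp: f_def)
  moreover have "integral {0<..} f = Gamma r"
    using hf by blast
  moreover have img: "g ` {0<..} = {0<..}"
  proof
    show "g ` {0<..} \<subseteq> {0<..}" using c by (auto simp: g_def)
    show "{0<..} \<subseteq> g ` {0<..}"
    proof
      fix t :: real assume "t \<in> {0<..}"
      then have "t = g (sqrt (t / c))" "sqrt (t / c) \<in> {0<..}"
        using c by (auto simp: g_def)
      then show "t \<in> g ` {0<..}" by blast
    qed
  qed
  moreover have "(\<lambda>x. \<bar>2 * c * x\<bar> * f (g x)) absolutely_integrable_on {0<..} \<and>
           integral {0<..} (\<lambda>x. \<bar>2 * c * x\<bar> * f (g x)) = Gamma r
     \<longleftrightarrow> f absolutely_integrable_on (g ` {0<..}) \<and> integral (g ` {0<..}) f = Gamma r"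
  proof (rule has_absolute_integral_change_of_variables_1')
    show "(g has_field_derivative 2 * c * x) (at x within {0<..})" for x
      unfolding g_def [abs_def] by (auto intro!: derivative_eq_intros)
    show "inj_on g {0<..}"
      using c by (auto simp: g_def inj_on_def power2_eq_iff)
  qed simp
  ultimately have *: "(\<lambda>x. \<bar>2 * c * x\<bar> * f (g x)) absolutely_integrable_on {0<..}"
    "integral {0<..} (\<lambda>x. \<bar>2 * c * x\<bar> * f (g x)) = Gamma r"
    by auto
  define h where "h a = exp (- c * a\<^sup>2) * a powr (2 * r - 1)" for a
  have eq: "\<bar>2 * c * x\<bar> * f (g x) = 2 * c powr r * h x" if "x \<in> {0<..}" for x
  proof -
    have x: "x > 0" using that by simp
    define P where "P = x powr (2 * r - 2)"
    have "(x\<^sup>2) powr (r - 1) = P"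
      using x powr_powr[of x 2 "r - 1"] by (simp add: P_def right_diff_distrib)
    then have 1: "(c * x\<^sup>2) powr (r - 1) = c powr r / c * P"
      using c by (simp add: powr_mult) (simp add: powr_diff)
    have 2: "x powr (2 * r - 1) = P * x"
      using x powr_add[of x "2 * r - 2" 1] by (simp add: P_def)
    have 3: "exp (- c * x\<^sup>2) = inverse (exp (c * x\<^sup>2))"
      by (simp add: exp_minus)
    show ?thesis
      unfolding f_def g_def h_def 1 2 3 using c x by (simp add: abs_mult divide_inverse)
  qed
  have "(\<lambda>x. \<bar>2 * c * x\<bar> * f (g x)) absolutely_integrable_on {0<..} \<longleftrightarrow>
      (\<lambda>x. 2 * c powr r * h x) absolutely_integrable_on {0<..}"
    by (rule set_integrable_cong) (simp_all add: eq)
  with *(1) have "(\<lambda>x. 2 * c powr r * h x) absolutely_integrable_on {0<..}"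
    by blast
  moreover have "integral {0<..} (\<lambda>x. \<bar>2 * c * x\<bar> * f (g x)) = integral {0<..} (\<lambda>x. 2 * c powr r * h x)"
    by (rule Henstock_Kurzweil_Integration.integral_cong) (rule eq)
  with *(2) have "integral {0<..} (\<lambda>x. 2 * c powr r * h x) = Gamma r"
    by simp
  ultimately have i: "integrable (lebesgue_on {0<..}) (\<lambda>x. 2 * c powr r * h x)"
    and j: "integral {0<..} (\<lambda>x. 2 * c powr r * h x) = Gamma r"
    by (simp_all add: absolutely_integrable_iff_lebesgue_on)
  have ih: "integrable (lebesgue_on {0<..}) h"
  proof -
    have "integrable (lebesgue_on {0<..}) (\<lambda>x. 1 / (2 * c powr r) * (2 * c powr r * h x))"
      by (intro integrable_mult_right i)
    then show ?thesis using c by simp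
  qed
  have "2 * c powr r * (LINT a|lebesgue_on {0<..}. h a) = Gamma r"
    using j by (simp add: lebesgue_integral_eq_integral[OF ih])
  then show "integrable (lebesgue_on {0<..}) h"
    and "(LINT a|lebesgue_on {0<..}. h a) = Gamma r / (2 * c powr r)"
    using ih c by (auto simp: field_simps)
qed

text \<open>The exponent \<open>2 * r - 1\<close> is normalised so that the constant function 1 has
  moment Gamma r / (2 c^r). Raising r by one inserts a factor a^2, which formally is -d/dc.\<close>

definition gaussian_moment :: "(real \<Rightarrow> real) \<Rightarrow> real \<Rightarrow> real \<Rightarrow> real" where
  "gaussian_moment \<phi> r c = (LINT a|lebesgue_on {0<..}. exp (- c * a\<^sup>2) * a powr (2 * r - 1) * \<phi> a)"

lemma gaussian_moment_bound:
  fixes c r :: real and \<phi> :: "real \<Rightarrow> real"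
  assumes c: "c > 0" and r: "r > 0"
    and cont: "continuous_on {0<..} \<phi>" and C: "\<And>a. a > 0 \<Longrightarrow> \<bar>\<phi> a\<bar> \<le> C"
  shows "integrable (lebesgue_on {0<..}) (\<lambda>a. exp (- c * a\<^sup>2) * a powr (2 * r - 1) * \<phi> a)"
    and "(LINT a|lebesgue_on {0<..}. \<bar>exp (- c * a\<^sup>2) * a powr (2 * r - 1) * \<phi> a\<bar>) \<le> C * (Gamma r / (2 * c powr r))"
proof -
  let ?h = "\<lambda>a. exp (- c * a\<^sup>2) * a powr (2 * r - 1)"
  have C0: "C \<ge> 0" using C[OF zero_less_one] abs_ge_zero[of "\<phi> 1"] by linarith
  have le: "\<bar>?h a * \<phi> a\<bar> \<le> C * ?h a" if "a > 0" for a
    using mult_left_mono[OF C[OF that], of "?h a"] by (simp add: abs_mult mult_ac)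
  have int: "integrable (lebesgue_on {0<..}) (\<lambda>a. C * ?h a)"
    by (intro integrable_mult_right gaussian_gamma c r)
  show *: "integrable (lebesgue_on {0<..}) (\<lambda>a. ?h a * \<phi> a)"
  proof (rule Bochner_Integration.integrable_bound[OF int])
    show "(\<lambda>a. ?h a * \<phi> a) \<in> borel_measurable (lebesgue_on {0<..})"
      by (intro continuous_imp_measurable_on_sets_lebesgue continuous_intros cont) auto
    show "AE a in lebesgue_on {0<..}. norm (?h a * \<phi> a) \<le> norm (C * ?h a)"
      using le C0 by (intro AE_I2) (auto simp: abs_mult)
  qed
  have "(LINT a|lebesgue_on {0<..}. \<bar>?h a * \<phi> a\<bar>) \<le> (LINT a|lebesgue_on {0<..}. C * ?h a)"
    using * by (intro integral_mono int integrable_abs) (use le in auto)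
  also have "\<dots> = C * (Gamma r / (2 * c powr r))"
    using gaussian_gamma(2)[OF c r] by simp
  finally show "(LINT a|lebesgue_on {0<..}. \<bar>?h a * \<phi> a\<bar>) \<le> C * (Gamma r / (2 * c powr r))" .
qed

text \<open>Termwise integration: \<open>sm\<close> makes the L1 norms summable through the bound C
  on \<phi>, and \<open>pt\<close> gives pointwise absolute convergence. It serves three expansions:
  of J_\<mu>(a^2) with \<phi> = 1, of exp (h a^2), and of J_{2\<nu>}(ax), the last two with \<phi> =
  \<open>square_J \<mu>\<close>.\<close>

lemma gaussian_moment_sums:
  fixes d :: "nat \<Rightarrow> complex" and r :: "nat \<Rightarrow> real" and \<phi> :: "real \<Rightarrow> real"
  assumes c: "c > 0" and r: "\<And>k. r k > 0"
    and cont: "continuous_on {0<..} \<phi>" and C: "\<And>a. a > 0 \<Longrightarrow> \<bar>\<phi> a\<bar> \<le> C"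
    and sm: "summable (\<lambda>k. norm (d k) * (Gamma (r k) / c powr r k))"
    and pt: "\<And>a. a > 0 \<Longrightarrow> summable (\<lambda>k. norm (d k) * a powr (2 * r k - 1))"
  shows "integrable (lebesgue_on {0<..})
           (\<lambda>a. \<Sum>k. d k * of_real (exp (- c * a\<^sup>2) * a powr (2 * r k - 1) * \<phi> a))"
    and "(\<lambda>k. d k * of_real (gaussian_moment \<phi> (r k) c)) sums
           (LINT a|lebesgue_on {0<..}. (\<Sum>k. d k * of_real (exp (- c * a\<^sup>2) * a powr (2 * r k - 1) * \<phi> a)))"
proof -
  let ?h = "\<lambda>k a. exp (- c * a\<^sup>2) * a powr (2 * r k - 1) * \<phi> a"
  let ?f = "\<lambda>k a. d k * of_real (?h k a)"
  note b = gaussian_moment_bound[OF c r cont C]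
  have int: "integrable (lebesgue_on {0<..}) (?f k)" for k
    by (intro integrable_mult_right integrable_of_real b)
  have nf: "norm (?f k a) = norm (d k) * \<bar>?h k a\<bar>" for k a
    by (simp only: norm_mult norm_of_real)
  have AE: "AE a in lebesgue_on {0<..}. summable (\<lambda>k. norm (?f k a))"
  proof (rule AE_I2)
    fix a :: real assume "a \<in> space (lebesgue_on {0<..})"
    then have "summable (\<lambda>k. (norm (d k) * a powr (2 * r k - 1)) * (exp (- c * a\<^sup>2) * \<bar>\<phi> a\<bar>))"
      by (intro summable_mult2 pt) simp
    then show "summable (\<lambda>k. norm (?f k a))"
      by (simp add: norm_mult abs_mult mult_ac)
  qed
  have sum: "summable (\<lambda>k. LINT a|lebesgue_on {0<..}. norm (?f k a))"
  proof (rule summable_comparison_test'[of "\<lambda>k. C / 2 * (norm (d k) * (Gamma (r k) / c powr r k))"])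
    show "summable (\<lambda>k. C / 2 * (norm (d k) * (Gamma (r k) / c powr r k)))"
      by (intro summable_mult sm)
    fix k :: nat
    have "norm (LINT a|lebesgue_on {0<..}. norm (?f k a)) = norm (d k) * (LINT a|lebesgue_on {0<..}. \<bar>?h k a\<bar>)"
      unfolding nf by (simp add: abs_mult)
    also have "\<dots> \<le> norm (d k) * (C * (Gamma (r k) / (2 * c powr r k)))"
      by (intro mult_left_mono b) auto
    finally show "norm (LINT a|lebesgue_on {0<..}. norm (?f k a)) \<le> C / 2 * (norm (d k) * (Gamma (r k) / c powr r k))"
      by (simp add: mult_ac)
  qed
  have eq: "(LINT a|lebesgue_on {0<..}. ?f k a) = d k * of_real (gaussian_moment \<phi> (r k) c)" for k
    unfolding gaussian_moment_def integral_complex_of_real [symmetric] by simp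
  show "integrable (lebesgue_on {0<..}) (\<lambda>a. \<Sum>k. ?f k a)"
    by (rule integrable_suminf[of "lebesgue_on {0<..}" ?f, OF int AE sum])
  show "(\<lambda>k. d k * of_real (gaussian_moment \<phi> (r k) c)) sums (LINT a|lebesgue_on {0<..}. (\<Sum>k. ?f k a))"
    using sums_integral[of "lebesgue_on {0<..}" ?f, OF int AE sum] unfolding eq .
qed

section \<open>Binomial series with Gamma coefficients\<close>

text \<open>The Pochhammer symbol in two guises: Gamma (q + k) / Gamma q, and (-1)^k k! times the
  binomial coefficient of -q over k.\<close>

lemma Gamma_add_of_nat:
  fixes q :: real
  assumes "q > 0"
  shows "Gamma (q + real k) / fact k = Gamma q * (- 1) ^ k * ((- q) gchoose k)"
proof -
  have "q \<notin> \<int>\<^sub>\<le>\<^sub>0" using assms by (auto elim!: nonpos_Ints_cases)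
  then have "pochhammer q k = Gamma (q + real k) / Gamma q" by (rule pochhammer_Gamma)
  moreover have "Gamma q \<noteq> 0" using Gamma_real_pos[OF assms] by simp
  ultimately have "Gamma (q + real k) = Gamma q * pochhammer q k" by simp
  moreover have "(- 1) ^ k * ((- 1) ^ k :: real) = 1"
    by (simp flip: power_mult_distrib)
  ultimately show ?thesis by (simp add: gbinomial_pochhammer)
qed

lemma Gamma_binomial_sums:
  fixes q z :: real
  assumes "q > 0" "\<bar>z\<bar> < 1"
  shows "(\<lambda>k. (- 1) ^ k * (Gamma (q + real k) / fact k) * z ^ k) sums (Gamma q * (1 + z) powr (- q))"
proof -
  have "(- 1) ^ k * (- 1) ^ k = (1 :: real)" for k
    by (simp flip: power_mult_distrib)
  then have "(- 1) ^ k * (Gamma (q + real k) / fact k) * z ^ k = Gamma q * (((- q) gchoose k) * z ^ k)" for k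
    unfolding Gamma_add_of_nat[OF assms(1)] by (simp add: mult_ac)
  then show ?thesis
    using sums_mult[OF gen_binomial_real[OF assms(2), of "- q"], of "Gamma q"] by simp
qed

text \<open>The alternating series at -z. Used with z \<ge> 0, it supplies the absolute convergence
  demanded by termwise integration.\<close>

lemma summable_Gamma_binomial:
  fixes q z :: real
  assumes "q > 0" "\<bar>z\<bar> < 1"
  shows "summable (\<lambda>k. Gamma (q + real k) / fact k * z ^ k)"
proof -
  have "(- 1) ^ k * (- 1) ^ k = (1 :: real)" for k
    by (simp flip: power_mult_distrib)
  then have "(\<lambda>k. (- 1) ^ k * (Gamma (q + real k) / fact k) * (- z) ^ k) = (\<lambda>k. Gamma (q + real k) / fact k * z ^ k)"
    by (simp add: power_minus[of z] mult_ac)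
  then show ?thesis
    using Gamma_binomial_sums[of q "- z"] assms by (simp add: sums_iff)
qed

subsection \<open>The moments of the Bessel factor\<close>

text \<open>Uniqueness of power series. It is used to read off derivatives from a series obtained by
  other means: at c > 0 from the moments, at 0 from the binomial series.\<close>

lemma higher_deriv_eq_coeff:
  fixes F :: "complex \<Rightarrow> complex"
  assumes "F holomorphic_on ball z r" "r > 0"
    and sums: "\<And>h. norm h < r \<Longrightarrow> (\<lambda>n. a n * h ^ n) sums F (z + h)"
  shows "(deriv ^^ n) F z = fact n * a n"
proof -
  have ev: "eventually (\<lambda>h. norm h < r) (nhds (0 :: complex))"
    using eventually_nhds_in_open[of "ball 0 r" "0 :: complex"] assms(2) by simp
  have "(\<lambda>h. F (z + h)) has_fps_expansion Abs_fps a"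
    by (rule has_fps_expansionI, rule eventually_mono[OF ev]) (simp add: sums)
  moreover have "(\<lambda>h. F (z + h)) has_fps_expansion Abs_fps (\<lambda>n. (deriv ^^ n) F z / fact n)"
  proof (rule has_fps_expansionI, rule eventually_mono[OF ev])
    fix h :: complex assume "norm h < r"
    then have "z + h \<in> ball z r" by (simp add: dist_norm)
    from holomorphic_power_series[OF assms(1) this]
    show "(\<lambda>n. fps_nth (Abs_fps (\<lambda>n. (deriv ^^ n) F z / fact n)) n * h ^ n) sums F (z + h)"
      by simp
  qed
  ultimately have "Abs_fps a = Abs_fps (\<lambda>n. (deriv ^^ n) F z / fact n)"
    by (rule fps_expansion_unique_complex)
  from arg_cong[OF this, of "\<lambda>G. fps_nth G n"] show ?thesis
    by simp
qed

lemma Gamma_duplication_real: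
  fixes z :: real
  assumes "z > 0"
  shows "Gamma (2 * z) = 2 powr (2 * z - 1) * (Gamma z * Gamma (z + 1 / 2)) / sqrt pi"
proof -
  have np: "complex_of_real w \<notin> \<int>\<^sub>\<le>\<^sub>0" if "w > 0" for w
    using that by (auto elim!: nonpos_Ints_cases simp: complex_eq_iff)
  have half: "complex_of_real z + 1 / 2 = complex_of_real (z + 1 / 2)" by simp
  have "complex_of_real z + 1 / 2 \<notin> \<int>\<^sub>\<le>\<^sub>0"
    unfolding half by (rule np) (use assms in simp)
  then have "Gamma (complex_of_real z) * Gamma (complex_of_real z + 1 / 2)
      = exp ((1 - 2 * complex_of_real z) * of_real (ln 2)) * of_real (sqrt pi) * Gamma (2 * complex_of_real z)"
    using np[OF assms] by (intro Gamma_legendre_duplication)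
  also have "2 * complex_of_real z = complex_of_real (2 * z)" by simp
  also have "(1 - complex_of_real (2 * z)) * of_real (ln 2) = complex_of_real ((1 - 2 * z) * ln 2)" by simp
  finally have "Gamma z * Gamma (z + 1 / 2) = exp ((1 - 2 * z) * ln 2) * sqrt pi * Gamma (2 * z)"
    unfolding half Gamma_complex_of_real exp_of_real of_real_mult [symmetric] of_real_eq_iff .
  moreover have "2 powr (2 * z - 1) * exp ((1 - 2 * z) * ln 2) = 1"
  proof -
    have "2 powr (2 * z - 1) * exp ((1 - 2 * z) * ln 2) = exp ((2 * z - 1) * ln 2 + (1 - 2 * z) * ln 2)"
      by (simp add: powr_def exp_add)
    also have "(2 * z - 1) * ln 2 + (1 - 2 * z) * ln 2 = 0" by (simp add: algebra_simps)
    finally show ?thesis by simp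
  qed
  ultimately show ?thesis
    by (simp add: mult.assoc [symmetric])
qed

definition square_J :: "real \<Rightarrow> real \<Rightarrow> real" where
  "square_J \<mu> a = real_J \<mu> (a\<^sup>2)"

lemma continuous_on_square_J: "continuous_on {0<..} (square_J \<mu>)"
  unfolding square_J_def [abs_def]
  by (rule continuous_on_compose2[OF continuous_on_real_J]) (auto intro!: continuous_intros)

lemma square_J_bounded:
  assumes "\<mu> \<ge> 0"
  obtains C where "\<And>a. a > 0 \<Longrightarrow> \<bar>square_J \<mu> a\<bar> \<le> C"
proof -
  obtain C where "\<And>t. t > 0 \<Longrightarrow> \<bar>real_J \<mu> t\<bar> \<le> C"
    using real_J_bounded[OF assms] by blast
  then show ?thesis
    by (intro that[of C]) (simp add: square_J_def)
qed

text \<open>Half of the constant in the classical Laplace transform of t^\<mu> J_\<mu>(t), which is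
  2^\<mu> Gamma(\<mu> + 1/2) / sqrt pi times (1 + s^2)^-(\<mu> + 1/2); the half comes from t =
  a^2.\<close>

definition moment_const :: "real \<Rightarrow> real" where
  "moment_const \<mu> = 2 powr (\<mu> - 1) * Gamma (\<mu> + 1 / 2) / sqrt pi"

text \<open>The j-th term produces Gamma (2z) with z = \<mu> + 1/2 + j. By duplication one factor,
  Gamma (z + 1/2), cancels the \<open>rGamma\<close> of the Bessel coefficient, and Gamma z / j! is
  left: a binomial series in 1/c^2, convergent because c > 1.\<close>

lemma square_J_moment_gt_1:
  assumes \<mu>: "\<mu> \<ge> 0" and c: "c > 1"
  shows "gaussian_moment (square_J \<mu>) (\<mu> + 1) c = moment_const \<mu> * (1 + c\<^sup>2) powr - (\<mu> + 1 / 2)"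
proof -
  \<comment> \<open>For a > 0, the product a^(2\<mu>+1) J_\<mu>(a^2) is the sum of d_j a^(2 r_j -
    1): the powers are a^(2\<mu>+1) (a^2/2)^\<mu> (a^4/4)^j.\<close>
  define d where "d j = bessel_coeff \<mu> j * (2 powr - \<mu> / 4 ^ j)" for j
  define r where "r j = 2 * \<mu> + 1 + 2 * real j" for j
  have r: "r k > 0" for k using \<mu> by (simp add: r_def)
  define G where "G j = Gamma (\<mu> + 1 / 2 + real j) / fact j" for j
  define A where "A = 2 powr (\<mu> - 1) / (sqrt pi * c powr (2 * \<mu> + 1))"
  have powr_split: "a powr (p + 2 * real j) = a powr p * (a\<^sup>2) ^ j" if "a > 0" for a p :: real and j
  proof -
    have "a powr (2 * real j) = a powr real (2 * j)" by simp
    also have "\<dots> = (a\<^sup>2) ^ j"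
      unfolding powr_realpow[OF that] by (rule power_mult)
    finally show ?thesis by (simp add: powr_add)
  qed
  have summand: "d j * (Gamma (r j) / (2 * c powr r j)) = A * ((- 1) ^ j * G j * (1 / c\<^sup>2) ^ j)" for j
  proof -
    define z where "z = \<mu> + 1 / 2 + real j"
    have z: "z > 0" using \<mu> by (simp add: z_def)
    have 1: "r j = 2 * z" by (simp add: r_def z_def)
    have "Gamma (z + 1 / 2) > 0" using z by (intro Gamma_real_pos) auto
    then have 2: "bessel_coeff \<mu> j * Gamma (z + 1 / 2) = (- 1) ^ j / fact j"
      by (simp add: bessel_coeff_def rGamma_inverse_Gamma z_def add.commute add.left_commute)
    have 3: "2 powr (2 * z - 1) * (2 powr - \<mu> / 4 ^ j) = 2 * 2 powr (\<mu> - 1)"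
    proof -
      have "2 powr (2 * z - 1) = 2 powr (2 * \<mu>) * 4 ^ j"
        using powr_split[of 2 "2 * \<mu>" j] by (simp add: z_def algebra_simps)
      moreover have "2 powr (2 * \<mu>) * 2 powr - \<mu> = 2 powr \<mu>"
        by (simp flip: powr_add)
      moreover have "2 powr \<mu> = 2 * 2 powr (\<mu> - 1)"
        by (simp add: powr_diff)
      ultimately show ?thesis by simp
    qed
    have 4: "c powr (2 * z) = c powr (2 * \<mu> + 1) * (c\<^sup>2) ^ j"
      using powr_split[of c "2 * \<mu> + 1" j] c by (simp add: z_def algebra_simps)
    have "d j * (Gamma (r j) / (2 * c powr r j)) = (bessel_coeff \<mu> j * Gamma (z + 1 / 2)) * Gamma z
        * (2 powr (2 * z - 1) * (2 powr - \<mu> / 4 ^ j)) / (2 * sqrt pi * c powr (2 * z))"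
      unfolding d_def 1 Gamma_duplication_real[OF z] by (simp add: mult_ac)
    also have "\<dots> = A * ((- 1) ^ j * G j * (1 / c\<^sup>2) ^ j)"
      unfolding 2 3 4 A_def G_def by (simp add: z_def power_one_over field_simps)
    finally show ?thesis .
  qed
  have Gpos: "G j \<ge> 0" for j
    using \<mu> Gamma_real_pos[of "\<mu> + 1 / 2 + real j"] by (simp add: G_def)
  have z1: "\<bar>1 / c\<^sup>2\<bar> < 1" using c by (simp add: power_strict_mono[of 1 c 2, simplified])
  have Apos: "A > 0" unfolding A_def using c by simp
  have "summable (\<lambda>j. 2 * A * (G j * (1 / c\<^sup>2) ^ j))"
    unfolding G_def using \<mu> by (intro summable_mult summable_Gamma_binomial z1) simp
  moreover have "norm (complex_of_real (d j)) * (Gamma (r j) / c powr r j) = 2 * A * (G j * (1 / c\<^sup>2) ^ j)" for j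
  proof -
    have "Gamma (r j) > 0" by (rule Gamma_real_pos[OF r])
    then have "norm (complex_of_real (d j)) * (Gamma (r j) / c powr r j) = \<bar>2 * (d j * (Gamma (r j) / (2 * c powr r j)))\<bar>"
      by (simp add: abs_mult)
    also have "\<dots> = 2 * A * (G j * (1 / c\<^sup>2) ^ j)"
      unfolding summand using Apos Gpos[of j] by (simp add: abs_mult power_abs)
    finally show ?thesis .
  qed
  ultimately have sm: "summable (\<lambda>k. norm (complex_of_real (d k)) * (Gamma (r k) / c powr r k))"
    by simp
  have dterm: "d k * a powr (2 * r k - 1) = a powr (2 * \<mu> + 1) * (a\<^sup>2 / 2) powr \<mu> * (bessel_coeff \<mu> k * ((a\<^sup>2)\<^sup>2 / 4) ^ k)"
    if "a > 0" for a k
  proof -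
    have "a powr (2 * r k - 1) = a powr (2 * \<mu> + 1) * a powr (2 * \<mu>) * (a\<^sup>2) ^ (2 * k)"
    proof -
      have "2 * r k - 1 = 2 * \<mu> + 1 + 2 * \<mu> + 2 * real (2 * k)" by (simp add: r_def)
      then show ?thesis
        by (simp only: powr_split[OF that] powr_add[of a "2 * \<mu> + 1" "2 * \<mu>"])
    qed
    moreover have "(a\<^sup>2 / 2) powr \<mu> = a powr (2 * \<mu>) * 2 powr - \<mu>"
    proof -
      have "(a\<^sup>2 / 2) powr \<mu> = (a\<^sup>2) powr \<mu> / 2 powr \<mu>"
        by (rule powr_divide)
      moreover have "(a\<^sup>2) powr \<mu> = a powr (2 * \<mu>)"
        using that powr_powr[of a 2 \<mu>] by simp
      moreover have "2 powr - \<mu> = inverse (2 powr \<mu>)"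
        by (rule powr_minus)
      ultimately show ?thesis
        by (simp only: divide_inverse)
    qed
    moreover have "((a\<^sup>2)\<^sup>2 / 4) ^ k = (a\<^sup>2) ^ (2 * k) / 4 ^ k"
      unfolding power_divide power_mult ..
    ultimately show ?thesis
      unfolding d_def by (simp only: divide_inverse mult_ac)
  qed
  have pt: "summable (\<lambda>k. norm (complex_of_real (d k)) * a powr (2 * r k - 1))" if "a > 0" for a
  proof -
    have "norm (complex_of_real (d k)) * a powr (2 * r k - 1)
        = a powr (2 * \<mu> + 1) * (a\<^sup>2 / 2) powr \<mu> * (\<bar>bessel_coeff \<mu> k\<bar> * \<bar>(a\<^sup>2)\<^sup>2 / 4\<bar> ^ k)" for k
      using arg_cong[OF dterm[OF that, of k], of abs] by (simp only: abs_mult power_abs norm_of_real abs_of_nonneg[OF powr_ge_zero])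
    then show ?thesis
      by (simp only:) (intro summable_mult summable_abs_bessel_core)
  qed
  have inner: "(\<Sum>k. of_real (d k) * complex_of_real (exp (- c * a\<^sup>2) * a powr (2 * r k - 1) * 1))
      = of_real (exp (- c * a\<^sup>2) * a powr (2 * (\<mu> + 1) - 1) * square_J \<mu> a)" if "a > 0" for a
  proof -
    have "(\<lambda>k. exp (- c * a\<^sup>2) * (a powr (2 * \<mu> + 1) * (a\<^sup>2 / 2) powr \<mu>) * (bessel_coeff \<mu> k * ((a\<^sup>2)\<^sup>2 / 4) ^ k)) sums
        (exp (- c * a\<^sup>2) * (a powr (2 * \<mu> + 1) * (a\<^sup>2 / 2) powr \<mu>) * bessel_core \<mu> ((a\<^sup>2)\<^sup>2 / 4))"
      unfolding bessel_core_def by (intro sums_mult summable_sums summable_bessel_core)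
    also have "(\<lambda>k. exp (- c * a\<^sup>2) * (a powr (2 * \<mu> + 1) * (a\<^sup>2 / 2) powr \<mu>) * (bessel_coeff \<mu> k * ((a\<^sup>2)\<^sup>2 / 4) ^ k))
        = (\<lambda>k. d k * (exp (- c * a\<^sup>2) * a powr (2 * r k - 1) * 1))"
    proof
      fix k
      have "d k * (exp (- c * a\<^sup>2) * a powr (2 * r k - 1) * 1) = exp (- c * a\<^sup>2) * (d k * a powr (2 * r k - 1))"
        by (simp only: mult_ac mult_1_right)
      then show "exp (- c * a\<^sup>2) * (a powr (2 * \<mu> + 1) * (a\<^sup>2 / 2) powr \<mu>) * (bessel_coeff \<mu> k * ((a\<^sup>2)\<^sup>2 / 4) ^ k)
          = d k * (exp (- c * a\<^sup>2) * a powr (2 * r k - 1) * 1)"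
        unfolding dterm[OF that] by (simp only: mult_ac)
    qed
    also have "exp (- c * a\<^sup>2) * (a powr (2 * \<mu> + 1) * (a\<^sup>2 / 2) powr \<mu>) * bessel_core \<mu> ((a\<^sup>2)\<^sup>2 / 4)
        = exp (- c * a\<^sup>2) * a powr (2 * (\<mu> + 1) - 1) * square_J \<mu> a"
    proof -
      have "2 * (\<mu> + 1) - 1 = 2 * \<mu> + 1" by simp
      then show ?thesis
        by (simp only: square_J_def real_J_def mult_ac)
    qed
    finally have "(\<lambda>k. complex_of_real (d k * (exp (- c * a\<^sup>2) * a powr (2 * r k - 1) * 1))) sums
        of_real (exp (- c * a\<^sup>2) * a powr (2 * (\<mu> + 1) - 1) * square_J \<mu> a)"
      by (rule sums_of_real)
    then show ?thesis by (simp only: of_real_mult sums_iff)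
  qed
  have c0: "c > 0" using c by simp
  have one: "gaussian_moment (\<lambda>_. 1) (r k) c = Gamma (r k) / (2 * c powr r k)" for k
    unfolding gaussian_moment_def using gaussian_gamma(2)[OF c0 r] by simp
  have "(\<lambda>k. of_real (d k) * complex_of_real (gaussian_moment (\<lambda>_. 1) (r k) c)) sums
      (LINT a|lebesgue_on {0<..}. (\<Sum>k. of_real (d k) * complex_of_real (exp (- c * a\<^sup>2) * a powr (2 * r k - 1) * 1)))"
    by (rule gaussian_moment_sums(2)[OF c0 r _ _ sm pt, where C = 1]) auto
  also have "(LINT a|lebesgue_on {0<..}. (\<Sum>k. of_real (d k) * complex_of_real (exp (- c * a\<^sup>2) * a powr (2 * r k - 1) * 1)))
      = (LINT a|lebesgue_on {0<..}. complex_of_real (exp (- c * a\<^sup>2) * a powr (2 * (\<mu> + 1) - 1) * square_J \<mu> a))"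
    by (intro Bochner_Integration.integral_cong refl) (simp only: inner space_restrict_space space_completion Int_iff greaterThan_iff)
  also have "\<dots> = of_real (gaussian_moment (square_J \<mu>) (\<mu> + 1) c)"
    unfolding gaussian_moment_def by (rule integral_complex_of_real)
  finally have "(\<lambda>k. complex_of_real (A * ((- 1) ^ k * G k * (1 / c\<^sup>2) ^ k))) sums
      of_real (gaussian_moment (square_J \<mu>) (\<mu> + 1) c)"
    by (simp only: one summand flip: of_real_mult)
  then have "(\<lambda>k. A * ((- 1) ^ k * G k * (1 / c\<^sup>2) ^ k)) sums gaussian_moment (square_J \<mu>) (\<mu> + 1) c"
    by (simp only: sums_of_real_iff)
  moreover have "(\<lambda>k. A * ((- 1) ^ k * G k * (1 / c\<^sup>2) ^ k)) sums
      (A * (Gamma (\<mu> + 1 / 2) * (1 + 1 / c\<^sup>2) powr - (\<mu> + 1 / 2)))"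
    unfolding G_def using \<mu> by (intro sums_mult Gamma_binomial_sums z1) simp
  ultimately have val: "gaussian_moment (square_J \<mu>) (\<mu> + 1) c
      = A * (Gamma (\<mu> + 1 / 2) * (1 + 1 / c\<^sup>2) powr - (\<mu> + 1 / 2))"
    by (rule sums_unique2)
  \<comment> \<open>The binomial series yields a power of 1 + 1/c^2 = (1 + c^2)/c^2; the split-off
    c^(2\<mu>+1) cancels the one in the denominator of A.\<close>
  have scale: "(1 + 1 / c\<^sup>2) powr - (\<mu> + 1 / 2) = (1 + c\<^sup>2) powr - (\<mu> + 1 / 2) * c powr (2 * \<mu> + 1)"
  proof -
    have "1 + 1 / c\<^sup>2 = (1 + c\<^sup>2) / c\<^sup>2" using c by (simp add: field_simps)
    moreover have "(c\<^sup>2) powr - (\<mu> + 1 / 2) = c powr - (2 * \<mu> + 1)"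
    proof -
      have e: "2 * - (\<mu> + 1 / 2) = - (2 * \<mu> + 1)" by simp
      have "(c\<^sup>2) powr - (\<mu> + 1 / 2) = (c powr 2) powr - (\<mu> + 1 / 2)" using c by simp
      also have "\<dots> = c powr - (2 * \<mu> + 1)" unfolding powr_powr e ..
      finally show ?thesis .
    qed
    ultimately have "(1 + 1 / c\<^sup>2) powr - (\<mu> + 1 / 2) = (1 + c\<^sup>2) powr - (\<mu> + 1 / 2) / c powr - (2 * \<mu> + 1)"
      by (simp only: powr_divide)
    then show ?thesis
      unfolding powr_minus[of c] by (simp only: divide_inverse inverse_inverse_eq)
  qed
  have alg: "p / (s * C) * (g * (X * C)) = p * g / s * X" if "C \<noteq> 0" for p s C g X :: real
    using that by simp
  have nz: "c powr (2 * \<mu> + 1) \<noteq> 0"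
    using c by simp
  show ?thesis
    unfolding val scale A_def moment_const_def by (rule alg[OF nz])
qed

section \<open>Analytic continuation of the moments\<close>

text \<open>A Laplace transform in the variable a^2. The parameter is complex so that the identity
  theorem applies and the higher moments appear as Taylor coefficients.\<close>

definition complex_moment :: "real \<Rightarrow> complex \<Rightarrow> complex" where
  "complex_moment \<mu> s = (LINT a|lebesgue_on {0<..}.
     exp (- s * of_real (a\<^sup>2)) * of_real (a powr (2 * (\<mu> + 1) - 1) * square_J \<mu> a))"

lemma complex_moment_of_real:
  "complex_moment \<mu> (of_real c) = of_real (gaussian_moment (square_J \<mu>) (\<mu> + 1) c)"
  unfolding complex_moment_def gaussian_moment_def integral_complex_of_real [symmetric]
  by (simp add: mult.assoc flip: exp_of_real)

text \<open>Expand exp (h a^2); each a^(2k) raises the moment index by k. As the Bessel factor is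
  bounded, the k-th term is O(Gamma (\<mu> + 1 + k) / k! (|h|/c)^k), which is summable for |h| <
  c.\<close>

lemma complex_moment_sums:
  assumes \<mu>: "\<mu> \<ge> 0" and c: "c > 0" and h: "norm h < c"
  shows "(\<lambda>k. h ^ k / fact k * of_real (gaussian_moment (square_J \<mu>) (\<mu> + 1 + real k) c)) sums
           complex_moment \<mu> (of_real c - h)"
proof -
  define d where "d k = h ^ k / fact k" for k :: nat
  define r where "r k = \<mu> + 1 + real k" for k
  obtain C where C: "\<And>a. a > 0 \<Longrightarrow> \<bar>square_J \<mu> a\<bar> \<le> C"
    using square_J_bounded[OF \<mu>] by blast
  have r: "r k > 0" for k using \<mu> by (simp add: r_def)
  have nd: "norm (d k) = norm h ^ k / fact k" for k
    by (simp add: d_def norm_divide norm_power)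
  have "summable (\<lambda>k. c powr - (\<mu> + 1) * (Gamma (\<mu> + 1 + real k) / fact k * (norm h / c) ^ k))"
  proof (intro summable_mult summable_Gamma_binomial)
    show "\<mu> + 1 > 0" using \<mu> by simp
    show "\<bar>norm h / c\<bar> < 1" using c h by simp
  qed
  moreover have "c powr - (\<mu> + 1) * (Gamma (\<mu> + 1 + real k) / fact k * (norm h / c) ^ k)
      = norm (d k) * (Gamma (r k) / c powr r k)" for k
  proof -
    have pr: "c powr r k = c powr (\<mu> + 1) * c ^ k"
    proof -
      have "c powr r k = c powr (\<mu> + 1) * c powr real k"
        unfolding r_def by (rule powr_add)
      also have "c powr real k = c ^ k"
        by (rule powr_realpow[OF c])
      finally show ?thesis .
    qed
    have "inverse P * (G / f * (norm h / c) ^ k) = norm h ^ k / f * (G / (P * c ^ k))"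
      if "P \<noteq> 0" "f \<noteq> 0" for P G f
      using that c by (simp add: power_divide field_simps)
    from this[of "c powr (\<mu> + 1)" "fact k" "Gamma (\<mu> + 1 + real k)"] show ?thesis
      unfolding nd pr using powr_minus[of c "\<mu> + 1"] c by (simp only: r_def) simp
  qed
  ultimately have sm: "summable (\<lambda>k. norm (d k) * (Gamma (r k) / c powr r k))"
    by (simp only:)
  have pw: "a powr (2 * r k - 1) = a powr (2 * (\<mu> + 1) - 1) * (a\<^sup>2) ^ k" if "a > 0" for a k
  proof -
    have "2 * r k - 1 = 2 * (\<mu> + 1) - 1 + real (2 * k)" by (simp add: r_def)
    then have "a powr (2 * r k - 1) = a powr (2 * (\<mu> + 1) - 1) * a powr real (2 * k)"
      by (simp only: powr_add)
    also have "a powr real (2 * k) = a ^ (2 * k)"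
      by (rule powr_realpow[OF that])
    also have "\<dots> = (a\<^sup>2) ^ k"
      by (rule power_mult)
    finally show ?thesis .
  qed
  have pt: "summable (\<lambda>k. norm (d k) * a powr (2 * r k - 1))" if "a > 0" for a
  proof -
    have "summable (\<lambda>k. a powr (2 * (\<mu> + 1) - 1) * (inverse (fact k) * (norm h * a\<^sup>2) ^ k))"
      by (intro summable_mult summable_exp)
    moreover have "a powr (2 * (\<mu> + 1) - 1) * (inverse (fact k) * (norm h * a\<^sup>2) ^ k)
        = norm (d k) * a powr (2 * r k - 1)" for k
      unfolding nd pw[OF that] power_mult_distrib divide_inverse by (simp only: mult_ac)
    ultimately show ?thesis by (simp only:)
  qed
  have inner: "(\<Sum>k. d k * complex_of_real (exp (- c * a\<^sup>2) * a powr (2 * r k - 1) * square_J \<mu> a))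
      = exp (- (of_real c - h) * of_real (a\<^sup>2)) * of_real (a powr (2 * (\<mu> + 1) - 1) * square_J \<mu> a)"
    if "a > 0" for a
  proof -
    define w where "w = h * of_real (a\<^sup>2)"
    define B where "B = complex_of_real (exp (- c * a\<^sup>2) * (a powr (2 * (\<mu> + 1) - 1) * square_J \<mu> a))"
    have "(\<lambda>k. B * (w ^ k /\<^sub>R fact k)) sums (B * exp w)"
      by (intro sums_mult exp_converges)
    moreover have "B * (w ^ k /\<^sub>R fact k) = d k * complex_of_real (exp (- c * a\<^sup>2) * a powr (2 * r k - 1) * square_J \<mu> a)" for k
      unfolding pw[OF that] B_def w_def d_def
      by (simp add: scaleR_conv_of_real power_mult_distrib divide_inverse mult_ac)
    moreover have "B * exp w = exp (- (of_real c - h) * of_real (a\<^sup>2)) * of_real (a powr (2 * (\<mu> + 1) - 1) * square_J \<mu> a)"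
    proof -
      have "exp (- (of_real c - h) * of_real (a\<^sup>2)) = exp (of_real (- c * a\<^sup>2)) * exp w"
        by (simp add: w_def algebra_simps flip: exp_add)
      also have "exp (complex_of_real (- c * a\<^sup>2)) = of_real (exp (- c * a\<^sup>2))"
        by (rule exp_of_real)
      finally show ?thesis by (simp only: B_def of_real_mult mult_ac)
    qed
    ultimately show ?thesis by (simp add: sums_iff)
  qed
  have "(\<lambda>k. d k * of_real (gaussian_moment (square_J \<mu>) (r k) c)) sums
      (LINT a|lebesgue_on {0<..}. (\<Sum>k. d k * complex_of_real (exp (- c * a\<^sup>2) * a powr (2 * r k - 1) * square_J \<mu> a)))"
    by (rule gaussian_moment_sums(2)[OF c r continuous_on_square_J C sm pt])
  also have "(LINT a|lebesgue_on {0<..}. (\<Sum>k. d k * complex_of_real (exp (- c * a\<^sup>2) * a powr (2 * r k - 1) * square_J \<mu> a)))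
      = complex_moment \<mu> (of_real c - h)"
    unfolding complex_moment_def
    by (intro Bochner_Integration.integral_cong refl) (use inner in auto)
  finally show ?thesis
    unfolding d_def r_def .
qed

lemma complex_moment_sums_shift:
  assumes "\<mu> \<ge> 0" "c > 0" "norm h < c"
  shows "(\<lambda>k. (- 1) ^ k / fact k * of_real (gaussian_moment (square_J \<mu>) (\<mu> + 1 + real k) c) * h ^ k) sums
           complex_moment \<mu> (of_real c + h)"
  using complex_moment_sums[of \<mu> c "- h"] assms by (simp add: power_minus[of h] mult_ac)

text \<open>The expansions at real c > 0 converge on discs of radius c tangent to the imaginary
  axis, and these discs cover the half-plane.\<close>

lemma holomorphic_on_complex_moment:
  assumes "\<mu> \<ge> 0"
  shows "complex_moment \<mu> holomorphic_on {s. Re s > 0}"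
proof -
  have ball: "complex_moment \<mu> holomorphic_on ball (of_real c) c" if "c > 0" for c
  proof (rule power_series_holomorphic)
    fix w assume "w \<in> ball (complex_of_real c) c"
    then have "norm (w - of_real c) < c" by (simp add: dist_norm norm_minus_commute)
    from complex_moment_sums_shift[OF assms that this]
    show "(\<lambda>k. (- 1) ^ k / fact k * of_real (gaussian_moment (square_J \<mu>) (\<mu> + 1 + real k) c) * (w - of_real c) ^ k)
        sums complex_moment \<mu> w"
      by simp
  qed
  have sub: "{s. Re s > 0} \<subseteq> (\<Union>c\<in>{0<..}. ball (complex_of_real c) c)"
  proof
    fix s assume "s \<in> {s. Re s > 0}"
    then have s: "Re s > 0" by simp
    \<comment> \<open>The condition |c - s| < c amounts to |s|^2 < 2 c Re s; the chosen c is twice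
      the threshold.\<close>
    define c where "c = (norm s)\<^sup>2 / Re s"
    have "s \<noteq> 0" using s by auto
    then have c: "c > 0" using s by (simp add: c_def)
    have "(norm (of_real c - s))\<^sup>2 = c\<^sup>2 - 2 * (c * Re s) + (norm s)\<^sup>2"
      unfolding cmod_power2 by (simp add: power2_eq_square algebra_simps)
    also have "c * Re s = (norm s)\<^sup>2" using s by (simp add: c_def)
    finally have "(norm (of_real c - s))\<^sup>2 < c\<^sup>2" using \<open>s \<noteq> 0\<close> by simp
    then have "norm (of_real c - s) < c" by (rule power2_less_imp_less) (use c in simp)
    then have "s \<in> ball (complex_of_real c) c" by (simp add: dist_norm)
    then show "s \<in> (\<Union>c\<in>{0<..}. ball (complex_of_real c) c)" using c by blast
  qed
  have "complex_moment \<mu> holomorphic_on (\<Union>c\<in>{0<..}. ball (complex_of_real c) c)"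
    by (intro holomorphic_on_UN_open) (use ball in auto)
  then show ?thesis
    using sub holomorphic_on_subset by blast
qed

definition moment_fun :: "real \<Rightarrow> complex \<Rightarrow> complex" where
  "moment_fun \<mu> s = (1 + s\<^sup>2) powr of_real (- (\<mu> + 1 / 2))"

text \<open>The value 1 + s^2 lies on the cut only for s = iy with |y| \<ge> 1, and such s are
  outside both regions.\<close>

lemma one_plus_square_notin_nonpos_Reals:
  fixes s :: complex
  assumes "Re s > 0 \<or> norm s < 1"
  shows "1 + s\<^sup>2 \<notin> \<real>\<^sub>\<le>\<^sub>0"
proof
  assume "1 + s\<^sup>2 \<in> \<real>\<^sub>\<le>\<^sub>0"
  then have *: "Re (1 + s\<^sup>2) \<le> 0" "Im (1 + s\<^sup>2) = 0"
    by (auto simp: complex_nonpos_Reals_iff)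
  then have im: "Re s * Im s = 0" by (auto simp: power2_eq_square)
  have re: "1 + (Re s)\<^sup>2 \<le> (Im s)\<^sup>2" using * by (simp add: power2_eq_square)
  from assms show False
  proof
    assume "Re s > 0"
    then have "(Im s)\<^sup>2 = 0" using im by simp
    then show False using re zero_le_power2[of "Re s"] by linarith
  next
    assume "norm s < 1"
    then have "\<bar>Im s\<bar> < 1" using abs_Im_le_cmod[of s] by linarith
    then have "(Im s)\<^sup>2 < 1" by (simp add: abs_square_less_1)
    then show False using re zero_le_power2[of "Re s"] by linarith
  qed
qed

text \<open>The region joins the half-plane, where the moments live, to a full neighbourhood of 0,
  where their limit is taken.\<close>

lemma holomorphic_on_moment_fun: "moment_fun \<mu> holomorphic_on {s. Re s > 0 \<or> norm s < 1}"
  unfolding moment_fun_def [abs_def]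
  by (intro holomorphic_intros) (use one_plus_square_notin_nonpos_Reals in auto)

text \<open>Identity theorem: both sides are holomorphic on the half-plane and agree on the ray c >
  1, which accumulates at 2.\<close>

lemma complex_moment_eq:
  assumes \<mu>: "\<mu> \<ge> 0" and s: "Re s > 0"
  shows "complex_moment \<mu> s = of_real (moment_const \<mu>) * moment_fun \<mu> s"
proof -
  let ?S = "{s. Re s > 0}"
  let ?f = "\<lambda>s. complex_moment \<mu> s - of_real (moment_const \<mu>) * moment_fun \<mu> s"
  have "?f s = 0"
  proof (rule analytic_continuation[where f = ?f and S = ?S and U = "of_real ` {1<..}" and \<xi> = 2])
    show "?f holomorphic_on ?S"
      by (intro holomorphic_intros holomorphic_on_complex_moment[OF \<mu>]
          holomorphic_on_subset[OF holomorphic_on_moment_fun]) auto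
    show "open ?S" by (rule open_halfspace_Re_gt)
    show "connected ?S" by (intro convex_connected convex_halfspace_Re_gt)
    show "complex_of_real ` {1<..} \<subseteq> ?S" by auto
    show "2 islimpt complex_of_real ` {1<..}"
    proof (rule islimptI)
      fix T :: "complex set" assume "2 \<in> T" "open T"
      then obtain e where e: "e > 0" "ball 2 e \<subseteq> T" using open_contains_ball by blast
      have "complex_of_real (2 + e / 2) \<in> ball 2 e"
        using e(1) by (simp add: dist_norm norm_divide)
      then show "\<exists>y\<in>complex_of_real ` {1<..}. y \<in> T \<and> y \<noteq> 2"
        using e by (intro bexI[of _ "complex_of_real (2 + e / 2)"]) (auto simp: complex_eq_iff)
    qed
    fix z assume "z \<in> complex_of_real ` {1<..}"
    then obtain c where c: "c > 1" "z = of_real c" by auto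
    have "moment_fun \<mu> z = of_real (1 + c\<^sup>2) powr of_real (- (\<mu> + 1 / 2))"
      by (simp add: moment_fun_def c)
    also have "\<dots> = of_real ((1 + c\<^sup>2) powr - (\<mu> + 1 / 2))"
      by (rule powr_of_real) (simp add: add_nonneg_nonneg)
    finally show "?f z = 0"
      unfolding c(2) complex_moment_of_real square_J_moment_gt_1[OF \<mu> c(1)] by simp
  qed (use s in auto)
  then show ?thesis by simp
qed

text \<open>Both sides are Taylor coefficients at c of the same function on the disc of radius c;
  the sign comes from differentiating exp (-s a^2).\<close>

lemma square_J_moment:
  assumes \<mu>: "\<mu> \<ge> 0" and c: "c > 0"
  shows "complex_of_real (gaussian_moment (square_J \<mu>) (\<mu> + 1 + real k) c)
    = (- 1) ^ k * of_real (moment_const \<mu>) * (deriv ^^ k) (moment_fun \<mu>) (of_real c)"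
proof -
  define K where "K = complex_of_real (moment_const \<mu>)"
  define a :: "nat \<Rightarrow> complex" where "a k = (- 1) ^ k / fact k * of_real (gaussian_moment (square_J \<mu>) (\<mu> + 1 + real k) c)" for k
  have pos: "Re s > 0" if "s \<in> ball (of_real c) c" for s
  proof -
    have "\<bar>Re (of_real c - s)\<bar> < c"
      using that abs_Re_le_cmod[of "of_real c - s"] by (simp add: dist_norm del: minus_complex.sel)
    then show ?thesis by simp
  qed
  have hol: "moment_fun \<mu> holomorphic_on ball (of_real c) c"
    by (rule holomorphic_on_subset[OF holomorphic_on_moment_fun]) (use pos in auto)
  have "(deriv ^^ k) (\<lambda>s. K * moment_fun \<mu> s) (of_real c) = fact k * a k"
  proof (rule higher_deriv_eq_coeff[OF _ c])
    show "(\<lambda>s. K * moment_fun \<mu> s) holomorphic_on ball (of_real c) c"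
      by (intro holomorphic_intros hol)
    fix h :: complex assume h: "norm h < c"
    then have "Re (of_real c + h) > 0" by (intro pos) (simp add: dist_norm)
    then show "(\<lambda>n. a n * h ^ n) sums (K * moment_fun \<mu> (of_real c + h))"
      using complex_moment_sums_shift[OF \<mu> c h] complex_moment_eq[OF \<mu>] by (simp add: a_def K_def)
  qed
  also have "(deriv ^^ k) (\<lambda>s. K * moment_fun \<mu> s) (of_real c) = K * (deriv ^^ k) (moment_fun \<mu>) (of_real c)"
    using c by (intro higher_deriv_cmult[OF hol]) auto
  finally have "(- 1) ^ k * (K * (deriv ^^ k) (moment_fun \<mu>) (of_real c)) = (- 1) ^ k * (fact k * a k)"
    by simp
  also have "\<dots> = of_real (gaussian_moment (square_J \<mu>) (\<mu> + 1 + real k) c)"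
    by (simp add: a_def)
  finally show ?thesis by (simp add: K_def mult.assoc)
qed

section \<open>The closed form near the origin\<close>

text \<open>Cauchy's inequality on circles of radius 1/2: for |s| \<le> 1/4 they stay in the disc of
  radius 3/4, away from i and -i. The radius accounts for 2^k, and M depends neither on k nor on
  s.\<close>

lemma norm_higher_deriv_moment_fun_le:
  obtains M where "\<And>k s. norm s \<le> 1 / 4 \<Longrightarrow> norm ((deriv ^^ k) (moment_fun \<mu>) s) \<le> fact k * M * 2 ^ k"
proof -
  have hol: "moment_fun \<mu> holomorphic_on ball 0 1"
    by (rule holomorphic_on_subset[OF holomorphic_on_moment_fun]) auto
  then have cont: "continuous_on (ball 0 1) (moment_fun \<mu>)"
    by (rule holomorphic_on_imp_continuous_on)
  have sub: "cball 0 (3 / 4) \<subseteq> ball (0 :: complex) 1" by auto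
  have "bounded (moment_fun \<mu> ` cball 0 (3 / 4))"
    by (intro compact_imp_bounded compact_continuous_image continuous_on_subset[OF cont] sub) auto
  then obtain M where M: "\<And>s. norm s \<le> 3 / 4 \<Longrightarrow> norm (moment_fun \<mu> s) \<le> M"
    unfolding bounded_iff by fastforce
  have "norm ((deriv ^^ k) (moment_fun \<mu>) s) \<le> fact k * M * 2 ^ k" if s: "norm s \<le> 1 / 4" for k s
  proof -
    have cb: "norm w \<le> 3 / 4" if "w \<in> cball s (1 / 2)" for w
      using that s norm_triangle_sub[of w s] by (simp add: dist_norm norm_minus_commute)
    then have sb: "cball s (1 / 2) \<subseteq> ball 0 1" by fastforce
    have "norm ((deriv ^^ k) (moment_fun \<mu>) s) \<le> fact k * M / (1 / 2) ^ k"
    proof (rule Cauchy_inequality)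
      show "moment_fun \<mu> holomorphic_on ball s (1 / 2)"
        using hol by (rule holomorphic_on_subset) (use sb ball_subset_cball in blast)
      show "continuous_on (cball s (1 / 2)) (moment_fun \<mu>)"
        by (rule continuous_on_subset[OF cont sb])
      show "norm (moment_fun \<mu> w) \<le> M" if "norm (s - w) = 1 / 2" for w
        using that by (intro M cb) (simp add: dist_norm)
    qed simp
    then show ?thesis by (simp add: power_one_over)
  qed
  then show ?thesis by (rule that)
qed

lemma tendsto_higher_deriv_moment_fun_0:
  "((\<lambda>\<epsilon>. (deriv ^^ k) (moment_fun \<mu>) (of_real \<epsilon>)) \<longlongrightarrow> (deriv ^^ k) (moment_fun \<mu>) 0) (at_right 0)"
proof -
  have "moment_fun \<mu> holomorphic_on ball 0 1"
    by (rule holomorphic_on_subset[OF holomorphic_on_moment_fun]) auto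
  then have "(deriv ^^ k) (moment_fun \<mu>) holomorphic_on ball 0 1"
    by (intro holomorphic_higher_deriv) auto
  then have "continuous_on (ball 0 1) ((deriv ^^ k) (moment_fun \<mu>))"
    by (rule holomorphic_on_imp_continuous_on)
  then have "isCont ((deriv ^^ k) (moment_fun \<mu>)) 0"
    by (rule continuous_on_interior) auto
  moreover have "((\<lambda>\<epsilon>. complex_of_real \<epsilon>) \<longlongrightarrow> of_real 0) (at_right 0)"
    by (intro tendsto_intros)
  ultimately show ?thesis
    using isCont_tendsto_compose[of 0 "(deriv ^^ k) (moment_fun \<mu>)"] by simp
qed

text \<open>Newton's binomial series in s^2 is the Taylor series at 0; the odd coefficients vanish
  because the function is even.\<close>

lemma higher_deriv_moment_fun_0:
  "(deriv ^^ k) (moment_fun \<mu>) 0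
    = (if even k then fact k * (of_real (- (\<mu> + 1 / 2)) gchoose (k div 2)) else 0)"
proof -
  define p where "p = complex_of_real (- (\<mu> + 1 / 2))"
  define a where "a k = (if even k then p gchoose (k div 2) else 0)" for k
  have "(deriv ^^ k) (moment_fun \<mu>) 0 = fact k * a k"
  proof (rule higher_deriv_eq_coeff[where r = 1])
    show "moment_fun \<mu> holomorphic_on ball 0 1"
      by (rule holomorphic_on_subset[OF holomorphic_on_moment_fun]) auto
    fix h :: complex assume h: "norm h < 1"
    then have "norm (h\<^sup>2) < 1" by (simp add: norm_power power_less_one_iff)
    then have "(\<lambda>n. (p gchoose n) * (h\<^sup>2) ^ n) sums moment_fun \<mu> (0 + h)"
      using gen_binomial_complex[of "h\<^sup>2" p] by (simp add: moment_fun_def p_def)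
    also have "(\<lambda>n. (p gchoose n) * (h\<^sup>2) ^ n) = (\<lambda>n. a (2 * n) * h ^ (2 * n))"
      by (simp add: a_def power_mult)
    finally show "(\<lambda>n. a n * h ^ n) sums moment_fun \<mu> (0 + h)"
      by (subst (asm) sums_mono_reindex) (auto simp: strict_mono_def a_def elim!: evenE)
  qed simp
  then show ?thesis by (simp add: a_def p_def)
qed

subsection \<open>The Abel integral\<close>

text \<open>The ratio of Bessel coefficients is 1 / ((k+1)(\<kappa>+k+1)) in modulus. A weight of
  factorial growth consumes the first factor, and the second still beats the geometric rate L y.
  Used for Gamma weights at fixed \<epsilon> and for k! in the limit.\<close>

lemma summable_bessel_coeff_weighted:
  assumes p: "\<And>k. p k \<ge> 0" "\<And>k. p (Suc k) \<le> L * real (Suc k) * p k" and y: "y \<ge> 0" and L: "L \<ge> 0"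
  shows "summable (\<lambda>k. \<bar>bessel_coeff \<kappa> k\<bar> * p k * y ^ k)"
proof (rule summable_ratio_test)
  fix k :: nat
  \<comment> \<open>Chosen so that L y \<le> |\<kappa> + k + 1| / 2, which gives the ratio
    1/2.\<close>
  assume k: "k \<ge> nat \<lceil>\<bar>\<kappa>\<bar> + 2 * L * y\<rceil>"
  then have k: "real k \<ge> \<bar>\<kappa>\<bar> + 2 * L * y" by linarith
  define b where "b = \<bar>bessel_coeff \<kappa> (Suc k)\<bar> * real (Suc k)"
  have b0: "b \<ge> 0" by (simp add: b_def)
  have bk: "b * \<bar>\<kappa> + real k + 1\<bar> = \<bar>bessel_coeff \<kappa> k\<bar>"
    using arg_cong[OF bessel_coeff_Suc[of \<kappa> k], of abs] by (simp add: b_def abs_mult mult.assoc)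
  have "\<bar>bessel_coeff \<kappa> (Suc k)\<bar> * p (Suc k) * y ^ Suc k
      \<le> \<bar>bessel_coeff \<kappa> (Suc k)\<bar> * (L * real (Suc k) * p k) * y ^ Suc k"
    using y by (intro mult_right_mono mult_left_mono p) auto
  also have "\<dots> = b * (L * y) * (p k * y ^ k)"
    by (simp add: b_def mult_ac)
  also have "\<dots> \<le> b * (\<bar>\<kappa> + real k + 1\<bar> / 2) * (p k * y ^ k)"
    using k b0 y p(1)[of k] by (intro mult_right_mono mult_left_mono) auto
  also have "\<dots> = 1 / 2 * (\<bar>bessel_coeff \<kappa> k\<bar> * p k * y ^ k)"
    unfolding bk[symmetric] by simp
  finally show "norm (\<bar>bessel_coeff \<kappa> (Suc k)\<bar> * p (Suc k) * y ^ Suc k)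
      \<le> 1 / 2 * norm (\<bar>bessel_coeff \<kappa> k\<bar> * p k * y ^ k)"
    using p(1)[of k] p(1)[of "Suc k"] y by (simp add: abs_mult)
qed simp

lemma bessel_series_sums:
  "(\<lambda>k. of_real (bessel_coeff \<nu> k) * (z / 2) ^ (2 * k)) sums bessel_series \<nu> z"
proof -
  have c: "(- 1) ^ k * rGamma (of_real \<nu> + of_nat k + 1) / fact k = complex_of_real (bessel_coeff \<nu> k)" for k
  proof -
    have "rGamma (complex_of_real \<nu> + of_nat k + 1) = rGamma (complex_of_real (\<nu> + real k + 1))" by simp
    also have "\<dots> = of_real (rGamma (\<nu> + real k + 1))" by (rule rGamma_complex_of_real)
    finally show ?thesis by (simp add: bessel_coeff_def)
  qed
  have "summable (\<lambda>k. norm (complex_of_real (bessel_coeff \<nu> k) * (z / 2) ^ (2 * k)))"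
    using summable_abs_bessel_core[of \<nu> "(norm (z / 2))\<^sup>2"]
    by (simp add: norm_mult norm_power power_mult norm_divide)
  then have "summable (\<lambda>k. complex_of_real (bessel_coeff \<nu> k) * (z / 2) ^ (2 * k))"
    by (rule summable_norm_cancel)
  then show ?thesis
    unfolding bessel_series_def c by (rule summable_sums)
qed

lemma bessel_J_nonzero:
  "z \<noteq> 0 \<Longrightarrow> bessel_J \<nu> z = (z / 2) powr of_real \<nu> * bessel_series \<nu> z"
  by (simp add: bessel_J_def)

lemma bessel_J_of_real:
  assumes "t > 0"
  shows "bessel_J \<nu> (of_real t) = of_real (real_J \<nu> t)"
proof -
  have "(\<lambda>k. complex_of_real (bessel_coeff \<nu> k * (t\<^sup>2 / 4) ^ k)) sums of_real (bessel_core \<nu> (t\<^sup>2 / 4))"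
    unfolding bessel_core_def by (intro sums_of_real summable_sums summable_bessel_core)
  moreover have "complex_of_real (bessel_coeff \<nu> k * (t\<^sup>2 / 4) ^ k)
      = of_real (bessel_coeff \<nu> k) * (of_real t / 2) ^ (2 * k)" for k
    by (simp add: power_mult power_divide)
  ultimately have "(\<lambda>k. of_real (bessel_coeff \<nu> k) * (of_real t / 2) ^ (2 * k)) sums
      complex_of_real (bessel_core \<nu> (t\<^sup>2 / 4))"
    by (simp only:)
  then have "bessel_series \<nu> (of_real t) = of_real (bessel_core \<nu> (t\<^sup>2 / 4))"
    by (rule sums_unique2[OF bessel_series_sums])
  moreover have "(complex_of_real t / 2) powr of_real \<nu> = of_real ((t / 2) powr \<nu>)"
    using powr_of_real[of "t / 2" \<nu>] assms by simp
  ultimately show ?thesis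
    using assms by (simp add: bessel_J_nonzero real_J_def)
qed

section \<open>Expansion of the integrand and removal of the weight\<close>

text \<open>The coefficient of a^(2\<nu>+2k) in the expansion of J_{2\<nu>}(ax) for a > 0.\<close>

definition integrand_coeff :: "real \<Rightarrow> complex \<Rightarrow> nat \<Rightarrow> complex" where
  "integrand_coeff \<nu> x k = (x / 2) powr of_real (2 * \<nu>) * (of_real (bessel_coeff (2 * \<nu>) k) * (x / 2) ^ (2 * k))"

lemma norm_integrand_coeff:
  "norm (integrand_coeff \<nu> x k)
    = norm ((x / 2) powr of_real (2 * \<nu>)) * (\<bar>bessel_coeff (2 * \<nu>) k\<bar> * ((norm (x / 2))\<^sup>2) ^ k)"
  unfolding integrand_coeff_def norm_mult norm_power norm_of_real power_mult ..

text \<open>With \<mu> = \<nu> + 1/2 the factor a^2 of the integrand and the power a^(2\<nu>+2k) of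
  the expansion are exactly the weight of the moment with index \<mu> + 1 + k.\<close>

lemma powr_moment_exponent:
  assumes "a > 0"
  shows "a powr (2 * (\<nu> + 1 / 2 + 1 + real k) - 1) = a\<^sup>2 * a powr (2 * \<nu>) * a ^ (2 * k)"
proof -
  have "2 * (\<nu> + 1 / 2 + 1 + real k) - 1 = (real 2 + 2 * \<nu>) + real (2 * k)"
    by simp
  then have "a powr (2 * (\<nu> + 1 / 2 + 1 + real k) - 1) = (a powr real 2 * a powr (2 * \<nu>)) * a powr real (2 * k)"
    by (simp only: powr_add)
  then show ?thesis
    by (simp only: powr_realpow[OF assms])
qed

lemma bessel_integrand_sums:
  assumes a: "a > 0" and x: "x \<noteq> 0"
  shows "(\<lambda>k. integrand_coeff \<nu> x k *
      of_real (exp (- \<epsilon> * a\<^sup>2) * a powr (2 * (\<nu> + 1 / 2 + 1 + real k) - 1) * square_J (\<nu> + 1 / 2) a)) sums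
    (exp (- \<epsilon> * a\<^sup>2) *\<^sub>R bessel_integrand \<nu> x a)"
proof -
  define E where "E = complex_of_real (exp (- \<epsilon> * a\<^sup>2) * a\<^sup>2 * a powr (2 * \<nu>) * square_J (\<nu> + 1 / 2) a) * (x / 2) powr of_real (2 * \<nu>)"
  \<comment> \<open>A positive real factor does not change the argument, so the principal power
    splits for every x.\<close>
  have "(of_real a * (x / 2)) powr of_real (2 * \<nu>) = of_real (a powr (2 * \<nu>)) * (x / 2) powr of_real (2 * \<nu>)"
    using a powr_of_real[of a "2 * \<nu>"] by (subst powr_times_real_left) auto
  then have "bessel_J (2 * \<nu>) (of_real a * x)
      = of_real (a powr (2 * \<nu>)) * (x / 2) powr of_real (2 * \<nu>) * bessel_series (2 * \<nu>) (of_real a * x)"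
    using a x by (subst bessel_J_nonzero) auto
  moreover have "bessel_J (\<nu> + 1 / 2) (complex_of_real (a\<^sup>2)) = of_real (square_J (\<nu> + 1 / 2) a)"
    using a by (subst bessel_J_of_real) (auto simp: square_J_def)
  ultimately have eq: "exp (- \<epsilon> * a\<^sup>2) *\<^sub>R bessel_integrand \<nu> x a = E * bessel_series (2 * \<nu>) (of_real a * x)"
    unfolding bessel_integrand_def E_def scaleR_conv_of_real by (simp only: of_real_mult mult_ac)
  have "(\<lambda>k. E * (of_real (bessel_coeff (2 * \<nu>) k) * (of_real a * x / 2) ^ (2 * k))) sums
      (E * bessel_series (2 * \<nu>) (of_real a * x))"
    by (intro sums_mult bessel_series_sums)
  moreover have "E * (of_real (bessel_coeff (2 * \<nu>) k) * (of_real a * x / 2) ^ (2 * k))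
      = integrand_coeff \<nu> x k *
      of_real (exp (- \<epsilon> * a\<^sup>2) * a powr (2 * (\<nu> + 1 / 2 + 1 + real k) - 1) * square_J (\<nu> + 1 / 2) a)" for k
  proof -
    have "(of_real a * x / 2) ^ (2 * k) = of_real (a ^ (2 * k)) * (x / 2) ^ (2 * k)"
      by (simp add: power_mult_distrib flip: times_divide_eq_right)
    then show ?thesis
      unfolding powr_moment_exponent[OF a] E_def integrand_coeff_def by (simp only: of_real_mult mult_ac)
  qed
  ultimately show ?thesis
    unfolding eq by (simp only:)
qed

text \<open>At fixed \<epsilon> the moments grow like k! / \<epsilon>^k up to powers of k, whereas
  the Bessel coefficients decay like 1 / k!^2 up to powers of k; hence the interchange is absolute
  for every x and every \<epsilon> > 0.\<close>

lemma gaussian_bessel_integrand: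
  assumes \<nu>: "\<nu> \<ge> - 1 / 4" and x: "x \<noteq> 0" and \<epsilon>: "\<epsilon> > 0"
  shows "(\<lambda>a. exp (- \<epsilon> * a\<^sup>2) *\<^sub>R bessel_integrand \<nu> x a) absolutely_integrable_on {0..}"
    and "(\<lambda>k. integrand_coeff \<nu> x k *
          ((- 1) ^ k * of_real (moment_const (\<nu> + 1 / 2)) * (deriv ^^ k) (moment_fun (\<nu> + 1 / 2)) (of_real \<epsilon>)))
        sums integral {0..} (\<lambda>a. exp (- \<epsilon> * a\<^sup>2) *\<^sub>R bessel_integrand \<nu> x a)"
proof -
  define \<mu> where "\<mu> = \<nu> + 1 / 2"
  define d where "d = integrand_coeff \<nu> x"
  define r where "r k = \<mu> + 1 + real k" for k
  define W where "W = norm ((x / 2) powr of_real (2 * \<nu>))"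
  define y where "y = (norm (x / 2))\<^sup>2"
  have \<mu>: "\<mu> \<ge> 0" using \<nu> by (simp add: \<mu>_def)
  have y: "y \<ge> 0" by (simp add: y_def)
  obtain C where C: "\<And>a. a > 0 \<Longrightarrow> \<bar>square_J \<mu> a\<bar> \<le> C"
    using square_J_bounded[OF \<mu>] by blast
  have r: "r k > 0" for k using \<mu> by (simp add: r_def)
  have nd: "norm (d k) = W * (\<bar>bessel_coeff (2 * \<nu>) k\<bar> * y ^ k)" for k
    unfolding d_def W_def y_def by (rule norm_integrand_coeff)
  have "summable (\<lambda>k. \<bar>bessel_coeff (2 * \<nu>) k\<bar> * Gamma (r k) * (y / \<epsilon>) ^ k)"
  proof (rule summable_bessel_coeff_weighted[where L = "\<mu> + 1"])
    show "Gamma (r k) \<ge> 0" for k using Gamma_real_pos[OF r] by (rule less_imp_le)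
    show "Gamma (r (Suc k)) \<le> (\<mu> + 1) * real (Suc k) * Gamma (r k)" for k
    proof -
      have "r (Suc k) = r k + 1" by (simp add: r_def)
      moreover have "r k \<notin> \<int>\<^sub>\<le>\<^sub>0" using r[of k] by (auto elim!: nonpos_Ints_cases)
      ultimately have "Gamma (r (Suc k)) = r k * Gamma (r k)"
        by (simp add: Gamma_plus1)
      \<comment> \<open>Since \<mu> \<ge> 0, \<mu> + 1 + k \<le> (\<mu> + 1)(k + 1); this fixes L =
        \<mu> + 1.\<close>
      moreover have "r k \<le> (\<mu> + 1) * real (Suc k)"
        using \<mu> by (simp add: r_def algebra_simps)
      ultimately show ?thesis
        using Gamma_real_pos[OF r[of k]] by (simp add: mult_right_mono)
    qed
  qed (use \<mu> y \<epsilon> in auto)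
  then have "summable (\<lambda>k. W * \<epsilon> powr - (\<mu> + 1) * (\<bar>bessel_coeff (2 * \<nu>) k\<bar> * Gamma (r k) * (y / \<epsilon>) ^ k))"
    by (rule summable_mult)
  moreover have "W * \<epsilon> powr - (\<mu> + 1) * (\<bar>bessel_coeff (2 * \<nu>) k\<bar> * Gamma (r k) * (y / \<epsilon>) ^ k)
      = norm (d k) * (Gamma (r k) / \<epsilon> powr r k)" for k
  proof -
    have pr: "\<epsilon> powr r k = \<epsilon> powr (\<mu> + 1) * \<epsilon> ^ k"
    proof -
      have "\<epsilon> powr r k = \<epsilon> powr (\<mu> + 1) * \<epsilon> powr real k"
        unfolding r_def by (rule powr_add)
      also have "\<epsilon> powr real k = \<epsilon> ^ k"
        by (rule powr_realpow[OF \<epsilon>])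
      finally show ?thesis .
    qed
    have "W * inverse P * (b * G * (y / \<epsilon>) ^ k) = W * (b * y ^ k) * (G / (P * \<epsilon> ^ k))"
      if "P \<noteq> 0" for P b G
      using that \<epsilon> by (simp add: power_divide field_simps)
    then show ?thesis
      unfolding nd pr powr_minus[of \<epsilon>] using \<epsilon> by simp
  qed
  ultimately have sm: "summable (\<lambda>k. norm (d k) * (Gamma (r k) / \<epsilon> powr r k))"
    by (simp only:)
  have pt: "summable (\<lambda>k. norm (d k) * a powr (2 * r k - 1))" if a: "a > 0" for a
  proof -
    have "summable (\<lambda>k. W * (a\<^sup>2 * a powr (2 * \<nu>)) * (\<bar>bessel_coeff (2 * \<nu>) k\<bar> * \<bar>y * a\<^sup>2\<bar> ^ k))"
      by (intro summable_mult summable_abs_bessel_core)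
    moreover have "W * (a\<^sup>2 * a powr (2 * \<nu>)) * (\<bar>bessel_coeff (2 * \<nu>) k\<bar> * \<bar>y * a\<^sup>2\<bar> ^ k)
        = norm (d k) * a powr (2 * r k - 1)" for k
    proof -
      have "\<bar>y * a\<^sup>2\<bar> ^ k = y ^ k * a ^ (2 * k)"
        using y by (simp add: abs_mult power_mult_distrib power_mult)
      then show ?thesis
        unfolding nd r_def \<mu>_def powr_moment_exponent[OF a] by (simp only: mult_ac)
    qed
    ultimately show ?thesis by (simp only:)
  qed
  let ?g = "\<lambda>a. exp (- \<epsilon> * a\<^sup>2) *\<^sub>R bessel_integrand \<nu> x a"
  have inner: "(\<Sum>k. d k * of_real (exp (- \<epsilon> * a\<^sup>2) * a powr (2 * r k - 1) * square_J \<mu> a)) = ?g a"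
    if "a > 0" for a
    using bessel_integrand_sums[OF that x, of \<nu> \<epsilon>] unfolding d_def r_def \<mu>_def by (rule sums_unique[symmetric])
  note sums = gaussian_moment_sums[OF \<epsilon> r continuous_on_square_J C sm pt]
  have int: "integrable (lebesgue_on {0<..}) ?g"
    using sums(1) by (rule Bochner_Integration.integrable_cong[THEN iffD1, rotated 2]) (use inner in auto)
  then show "?g absolutely_integrable_on {0..}"
    by (simp add: absolutely_integrable_iff_lebesgue_on flip: absolutely_integrable_greaterThan_0_iff)
  have "(LINT a|lebesgue_on {0<..}. (\<Sum>k. d k * of_real (exp (- \<epsilon> * a\<^sup>2) * a powr (2 * r k - 1) * square_J \<mu> a)))
      = (LINT a|lebesgue_on {0<..}. ?g a)"
    by (intro Bochner_Integration.integral_cong refl) (use inner in auto)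
  also have "\<dots> = integral {0<..} ?g"
    using int by (rule lebesgue_integral_eq_integral) simp
  also have "\<dots> = integral {0..} ?g"
    unfolding integral_def has_integral_greaterThan_0_iff integrable_on_def ..
  finally have "(\<lambda>k. d k * of_real (gaussian_moment (square_J \<mu>) (r k) \<epsilon>)) sums integral {0..} ?g"
    using sums(2) by simp
  then show "(\<lambda>k. integrand_coeff \<nu> x k *
          ((- 1) ^ k * of_real (moment_const (\<nu> + 1 / 2)) * (deriv ^^ k) (moment_fun (\<nu> + 1 / 2)) (of_real \<epsilon>)))
        sums integral {0..} ?g"
    unfolding r_def square_J_moment[OF \<mu> \<epsilon>] unfolding d_def \<mu>_def .
qed

text \<open>The majorant of the previous summation blows up as \<epsilon> tends to 0. After
  rewriting the moments as derivatives, the Cauchy bound gives a majorant B free of \<epsilon>, and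
  Tannery's theorem applies.\<close>

lemma has_abel_integral_bessel_integrand_suminf:
  assumes \<nu>: "\<nu> \<ge> - 1 / 4" and x: "x \<noteq> 0"
  shows "has_abel_integral (bessel_integrand \<nu> x)
    (\<Sum>k. integrand_coeff \<nu> x k *
          ((- 1) ^ k * of_real (moment_const (\<nu> + 1 / 2)) * (deriv ^^ k) (moment_fun (\<nu> + 1 / 2)) 0))"
proof -
  define K where "K = complex_of_real (moment_const (\<nu> + 1 / 2))"
  define g where "g = moment_fun (\<nu> + 1 / 2)"
  define d where "d = integrand_coeff \<nu> x"
  define W where "W = norm ((x / 2) powr of_real (2 * \<nu>))"
  define y where "y = (norm (x / 2))\<^sup>2"
  have nd: "norm (d k) = W * (\<bar>bessel_coeff (2 * \<nu>) k\<bar> * y ^ k)" for k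
    unfolding d_def W_def y_def by (rule norm_integrand_coeff)
  obtain M where M: "\<And>k s. norm s \<le> 1 / 4 \<Longrightarrow> norm ((deriv ^^ k) g s) \<le> fact k * M * 2 ^ k"
    using norm_higher_deriv_moment_fun_le[of "\<nu> + 1 / 2"] unfolding g_def by blast
  define B where "B k = W * norm K * M * (\<bar>bessel_coeff (2 * \<nu>) k\<bar> * fact k * (2 * y) ^ k)" for k
  have "summable B"
    unfolding B_def [abs_def]
    by (intro summable_mult summable_bessel_coeff_weighted[where L = 1]) (auto simp: y_def)
  \<comment> \<open>For 0 < \<epsilon> < 1/4 the derivative bound is uniform; Tannery's theorem
    wants it on the product filter in (k, \<epsilon>).\<close>
  have "eventually (\<lambda>\<epsilon>::real. \<epsilon> \<in> {0<..<1/4}) (at_right 0)"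
    by (rule eventually_at_right_real) simp
  then have "eventually (\<lambda>p. True \<and> snd p \<in> {0<..<1/4::real}) (sequentially \<times>\<^sub>F at_right 0)"
    using eventually_prodI[of "\<lambda>_::nat. True" sequentially "\<lambda>\<epsilon>::real. \<epsilon> \<in> {0<..<1/4}" "at_right 0"] by simp
  then have bound: "eventually (\<lambda>(k, \<epsilon>). norm (d k * ((- 1) ^ k * K * (deriv ^^ k) g (of_real \<epsilon>))) \<le> B k)
      (sequentially \<times>\<^sub>F at_right 0)"
  proof (rule eventually_mono)
    fix p :: "nat \<times> real" assume p: "True \<and> snd p \<in> {0<..<1/4}"
    obtain k \<epsilon> where [simp]: "p = (k, \<epsilon>)" by (cases p)
    have "norm ((deriv ^^ k) g (of_real \<epsilon>)) \<le> fact k * M * 2 ^ k"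
      using p by (intro M) auto
    then have "norm (d k) * norm K * norm ((deriv ^^ k) g (of_real \<epsilon>)) \<le> norm (d k) * norm K * (fact k * M * 2 ^ k)"
      by (rule mult_left_mono) auto
    also have "\<dots> = B k"
      unfolding nd B_def power_mult_distrib by (simp only: mult_ac)
    finally show "case p of (k, \<epsilon>) \<Rightarrow> norm (d k * ((- 1) ^ k * K * (deriv ^^ k) g (of_real \<epsilon>))) \<le> B k"
      by (simp add: norm_mult norm_power mult_ac)
  qed
  have "((\<lambda>\<epsilon>. \<Sum>k. d k * ((- 1) ^ k * K * (deriv ^^ k) g (of_real \<epsilon>))) \<longlongrightarrow>
      (\<Sum>k. d k * ((- 1) ^ k * K * (deriv ^^ k) g 0))) (at_right (0::real))"
  proof (rule tannerys_theorem[THEN conjunct2, THEN conjunct2])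
    show "((\<lambda>\<epsilon>. d k * ((- 1) ^ k * K * (deriv ^^ k) g (of_real \<epsilon>))) \<longlongrightarrow> d k * ((- 1) ^ k * K * (deriv ^^ k) g 0)) (at_right 0)" for k
      unfolding g_def by (intro tendsto_mult tendsto_const tendsto_higher_deriv_moment_fun_0)
  qed (use bound \<open>summable B\<close> in auto)
  moreover have "eventually (\<lambda>\<epsilon>. (\<Sum>k. d k * ((- 1) ^ k * K * (deriv ^^ k) g (of_real \<epsilon>)))
      = integral {0..} (\<lambda>a. exp (- \<epsilon> * a\<^sup>2) *\<^sub>R bessel_integrand \<nu> x a)) (at_right 0)"
    using eventually_at_right_less[of 0]
  proof (rule eventually_mono)
    fix \<epsilon> :: real assume "0 < \<epsilon>"
    from gaussian_bessel_integrand(2)[OF \<nu> x this]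
    show "(\<Sum>k. d k * ((- 1) ^ k * K * (deriv ^^ k) g (of_real \<epsilon>)))
      = integral {0..} (\<lambda>a. exp (- \<epsilon> * a\<^sup>2) *\<^sub>R bessel_integrand \<nu> x a)"
      unfolding d_def K_def g_def by (rule sums_unique[symmetric])
  qed
  ultimately have "((\<lambda>\<epsilon>. integral {0..} (\<lambda>a. exp (- \<epsilon> * a\<^sup>2) *\<^sub>R bessel_integrand \<nu> x a)) \<longlongrightarrow>
      (\<Sum>k. d k * ((- 1) ^ k * K * (deriv ^^ k) g 0))) (at_right 0)"
    by (rule Lim_transform_eventually)
  then show ?thesis
    using gaussian_bessel_integrand(1)[OF \<nu> x]
    unfolding has_abel_integral_def d_def K_def g_def by blast
qed

section \<open>Identification of the limit\<close>

text \<open>With z = \<nu> + 1/2 + m, the coefficient of J_{2\<nu>} at index 2m contains 1 / Gamma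
  (2z). Duplication splits this: 1 / Gamma z belongs to the m-th coefficient of J_{\<nu>-1/2}, and
  Gamma (z + 1/2) = Gamma (\<nu> + 1 + m) cancels against the binomial coefficient.\<close>

lemma even_coeff_identity:
  assumes \<nu>: "\<nu> \<ge> - 1 / 4"
  shows "bessel_coeff (2 * \<nu>) (2 * m) * moment_const (\<nu> + 1 / 2) * (fact (2 * m) * ((- (\<nu> + 1)) gchoose m))
    = 2 powr - (\<nu> + 1 / 2) * (bessel_coeff (\<nu> - 1 / 2) m / 4 ^ m)"
proof -
  define z where "z = \<nu> + 1 / 2 + real m"
  define A where "A = Gamma (\<nu> + 1)"
  define B where "B = Gamma (z + 1 / 2)"
  define D where "D = Gamma z"
  have z: "z > 0" using \<nu> by (simp add: z_def)
  have A: "A > 0" unfolding A_def using \<nu> by (intro Gamma_real_pos) auto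
  have B: "B > 0" unfolding B_def using z by (intro Gamma_real_pos) auto
  have D: "D > 0" unfolding D_def using z by (intro Gamma_real_pos) auto
  define s where "s = (- 1 :: real) ^ m"
  have ss: "s * s = 1" unfolding s_def by (simp flip: power_mult_distrib)
  have G: "Gamma (2 * z) = 2 powr (2 * z - 1) * (D * B) / sqrt pi"
    unfolding B_def D_def by (rule Gamma_duplication_real[OF z])
  have b1: "bessel_coeff (2 * \<nu>) (2 * m) * fact (2 * m) = sqrt pi / (2 powr (2 * z - 1) * (D * B))"
  proof -
    have "2 * \<nu> + real (2 * m) + 1 = 2 * z" by (simp add: z_def)
    then have "bessel_coeff (2 * \<nu>) (2 * m) * fact (2 * m) = rGamma (2 * z)"
      unfolding bessel_coeff_def by simp
    then show ?thesis
      unfolding rGamma_inverse_Gamma G by (simp add: inverse_eq_divide)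
  qed
  have "\<nu> + 1 + real m = z + 1 / 2" by (simp add: z_def)
  then have "B / fact m = A * s * ((- (\<nu> + 1)) gchoose m)"
    using Gamma_add_of_nat[of "\<nu> + 1" m] \<nu> by (simp add: A_def B_def s_def)
  then have "s * (B / fact m) = (s * s) * (A * ((- (\<nu> + 1)) gchoose m))"
    by simp
  then have b2: "A * ((- (\<nu> + 1)) gchoose m) = s * (B / fact m)"
    unfolding ss by simp
  have b3: "bessel_coeff (\<nu> - 1 / 2) m = s / (fact m * D)"
  proof -
    have "\<nu> - 1 / 2 + real m + 1 = z" by (simp add: z_def)
    then show ?thesis
      unfolding bessel_coeff_def rGamma_inverse_Gamma by (simp add: s_def D_def inverse_eq_divide)
  qed
  have b4: "moment_const (\<nu> + 1 / 2) = 2 powr (\<nu> - 1 / 2) * A / sqrt pi"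
  proof -
    have "\<nu> + 1 / 2 - 1 = \<nu> - 1 / 2" "\<nu> + 1 / 2 + 1 / 2 = \<nu> + 1" by auto
    then show ?thesis unfolding moment_const_def A_def by (simp only:)
  qed
  have b5: "2 powr (\<nu> - 1 / 2) = 2 powr (2 * z - 1) * (2 powr - (\<nu> + 1 / 2) / 4 ^ m)"
  proof -
    have "(4 :: real) ^ m = 2 ^ (2 * m)" by (simp add: power_mult)
    also have "\<dots> = 2 powr real (2 * m)" by (rule powr_realpow[symmetric]) simp
    finally have 4: "(4 :: real) ^ m = 2 powr real (2 * m)" .
    have e: "2 * z - 1 + (- (\<nu> + 1 / 2)) = \<nu> - 1 / 2 + real (2 * m)" by (simp add: z_def)
    have "2 powr (2 * z - 1) * 2 powr - (\<nu> + 1 / 2) = 2 powr (\<nu> - 1 / 2) * 2 powr real (2 * m)"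
      unfolding powr_add[symmetric] e ..
    then show ?thesis
      unfolding 4 by (simp add: field_simps)
  qed
  define p where "p = 2 powr (2 * z - 1)"
  define q where "q = 2 powr - (\<nu> + 1 / 2) / 4 ^ m"
  have p: "p > 0" by (simp add: p_def)
  have "bessel_coeff (2 * \<nu>) (2 * m) * moment_const (\<nu> + 1 / 2) * (fact (2 * m) * ((- (\<nu> + 1)) gchoose m))
      = (bessel_coeff (2 * \<nu>) (2 * m) * fact (2 * m)) * (2 powr (\<nu> - 1 / 2) / sqrt pi) * (A * ((- (\<nu> + 1)) gchoose m))"
    unfolding b4 by simp
  also have "\<dots> = sqrt pi / (p * (D * B)) * (p * q / sqrt pi) * (s * (B / fact m))"
    unfolding b1 b2 b5 p_def q_def ..
  also have "\<dots> = q * (s / (fact m * D))"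
    using p B D by (simp add: field_simps)
  also have "\<dots> = 2 powr - (\<nu> + 1 / 2) * (bessel_coeff (\<nu> - 1 / 2) m / 4 ^ m)"
    unfolding b3 q_def by simp
  finally show ?thesis .
qed

lemma bessel_integrand_limit_sums:
  assumes \<nu>: "\<nu> \<ge> - 1 / 4" and x: "x \<noteq> 0"
  shows "(\<lambda>k. integrand_coeff \<nu> x k *
          ((- 1) ^ k * of_real (moment_const (\<nu> + 1 / 2)) * (deriv ^^ k) (moment_fun (\<nu> + 1 / 2)) 0)) sums
    (x / 4 * bessel_J_log (\<nu> - 1 / 2) (2 * Ln (x / 2)))"
proof -
  let ?f = "\<lambda>k. integrand_coeff \<nu> x k *
          ((- 1) ^ k * of_real (moment_const (\<nu> + 1 / 2)) * (deriv ^^ k) (moment_fun (\<nu> + 1 / 2)) 0)"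
  define P where "P = (x / 2) powr of_real (2 * \<nu>) * of_real (2 powr - (\<nu> + 1 / 2))"
  have arg: "exp (2 * Ln (x / 2)) = x\<^sup>2 / 4"
    using x by (simp add: exp_double power_divide)
  \<comment> \<open>Formally (x/4) (x^2/8)^(\<nu>-1/2) = (x/2)^(2\<nu>) 2^-(\<nu>+1/2). Working with
    the logarithm 2 Ln (x/2) keeps this valid whatever the argument of x.\<close>
  have pre: "x / 4 * exp (of_real (\<nu> - 1 / 2) * (2 * Ln (x / 2) - of_real (ln 2))) = P"
  proof -
    have "of_real (\<nu> - 1 / 2) * (2 * Ln (x / 2) - of_real (ln 2))
        = of_real (2 * \<nu>) * Ln (x / 2) + of_real (- (\<nu> - 1 / 2) * ln 2) - Ln (x / 2)"
      by (simp add: algebra_simps)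
    then have "exp (of_real (\<nu> - 1 / 2) * (2 * Ln (x / 2) - of_real (ln 2)))
        = exp (of_real (2 * \<nu>) * Ln (x / 2)) * exp (of_real (- (\<nu> - 1 / 2) * ln 2)) / exp (Ln (x / 2))"
      by (simp only: exp_add exp_diff)
    also have "exp (Ln (x / 2)) = x / 2" using x by simp
    also have "exp (of_real (2 * \<nu>) * Ln (x / 2)) = (x / 2) powr of_real (2 * \<nu>)"
      using x by (simp add: powr_def)
    also have "exp (complex_of_real (- (\<nu> - 1 / 2) * ln 2)) = of_real (2 powr - (\<nu> - 1 / 2))"
      unfolding exp_of_real by (simp add: powr_def)
    finally have "x / 4 * exp (of_real (\<nu> - 1 / 2) * (2 * Ln (x / 2) - of_real (ln 2)))
        = (x / 2) powr of_real (2 * \<nu>) * (of_real (2 powr - (\<nu> - 1 / 2)) / 2)"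
      using x by (simp add: field_simps)
    also have "2 powr - (\<nu> - 1 / 2) = 2 powr - (\<nu> + 1 / 2) * 2"
    proof -
      have "- (\<nu> - 1 / 2) = - (\<nu> + 1 / 2) + 1" by simp
      then have "2 powr - (\<nu> - 1 / 2) = 2 powr - (\<nu> + 1 / 2) * 2 powr 1" by (simp only: powr_add)
      then show ?thesis by simp
    qed
    finally show ?thesis by (simp add: P_def)
  qed
  have "(\<lambda>m. P * (of_real (bessel_coeff (\<nu> - 1 / 2) m) * (x\<^sup>2 / 4 / 2) ^ (2 * m))) sums
      (P * bessel_series (\<nu> - 1 / 2) (x\<^sup>2 / 4))"
    by (intro sums_mult bessel_series_sums)
  also have "P * bessel_series (\<nu> - 1 / 2) (x\<^sup>2 / 4) = x / 4 * bessel_J_log (\<nu> - 1 / 2) (2 * Ln (x / 2))"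
    unfolding bessel_J_log_def arg pre[symmetric] by (simp only: mult.assoc)
  \<comment> \<open>Only even indices survive, and (x/2)^(4m) / 4^m = (x^2/8)^(2m), the power in the
    series of J at x^2/4.\<close>
  also have "(\<lambda>m. P * (of_real (bessel_coeff (\<nu> - 1 / 2) m) * (x\<^sup>2 / 4 / 2) ^ (2 * m))) = (\<lambda>m. ?f (2 * m))"
  proof
    fix m
    have g: "complex_of_real (- (\<nu> + 1)) gchoose m = of_real ((- (\<nu> + 1)) gchoose m)"
      by (simp add: gbinomial_prod_rev)
    have e: "- (\<nu> + 1 / 2 + 1 / 2) = - (\<nu> + 1)" "2 * m div 2 = m" by simp_all
    have "?f (2 * m) = (x / 2) powr of_real (2 * \<nu>) * (x / 2) ^ (2 * (2 * m)) *
        of_real (bessel_coeff (2 * \<nu>) (2 * m) * moment_const (\<nu> + 1 / 2) * (fact (2 * m) * ((- (\<nu> + 1)) gchoose m)))"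
      unfolding integrand_coeff_def higher_deriv_moment_fun_0 e g
      by simp
    also have "\<dots> = P * (of_real (bessel_coeff (\<nu> - 1 / 2) m) * ((x / 2) ^ (2 * (2 * m)) / 4 ^ m))"
      unfolding even_coeff_identity[OF \<nu>] P_def by simp
    also have "(x / 2) ^ (2 * (2 * m)) / 4 ^ m = (x\<^sup>2 / 4 / 2) ^ (2 * m)"
      by (simp add: power_mult power_divide flip: power_mult_distrib)
    finally show "P * (of_real (bessel_coeff (\<nu> - 1 / 2) m) * (x\<^sup>2 / 4 / 2) ^ (2 * m)) = ?f (2 * m)"
      by simp
  qed
  finally show ?thesis
    by (subst (asm) sums_mono_reindex) (auto simp: strict_mono_def higher_deriv_moment_fun_0 elim!: evenE)
qed

lemma has_abel_integral_bessel_integrand: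
  assumes "\<nu> \<ge> - 1 / 4" and "x \<noteq> 0"
  shows "has_abel_integral (bessel_integrand \<nu> x) (x / 4 * bessel_J_log (\<nu> - 1 / 2) (2 * Ln (x / 2)))"
  using has_abel_integral_bessel_integrand_suminf[OF assms]
  unfolding sums_unique[OF bessel_integrand_limit_sums[OF assms], symmetric] .

subsection \<open>Convergence for real argument\<close>

lemma tendsto_integral_at_top_absolutely_integrable:
  fixes f :: "real \<Rightarrow> 'a::euclidean_space"
  assumes "f absolutely_integrable_on {a..}"
  shows "((\<lambda>R. integral {a..R} f) \<longlongrightarrow> integral {a..} f) at_top"
proof -
  have "f absolutely_integrable_on {a..R}" for R
    using assms by (rule set_integrable_subset) auto
  then have "set_lebesgue_integral lebesgue {a..R} f = integral {a..R} f" for R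
    by (rule set_lebesgue_integral_eq_integral)
  moreover have "set_lebesgue_integral lebesgue {a..} f = integral {a..} f"
    using assms by (rule set_lebesgue_integral_eq_integral)
  ultimately show ?thesis
    using tendsto_set_lebesgue_integral_at_top[OF _ assms] by simp
qed

text \<open>Hake's principle: the gauge integral over a half-line includes conditionally convergent
  improper integrals.\<close>

lemma has_integral_atLeast_if_tendsto:
  fixes f :: "real \<Rightarrow> real"
  assumes int: "\<And>R. f integrable_on {a..R}" and lim: "((\<lambda>R. integral {a..R} f) \<longlongrightarrow> L) at_top"
  shows "(f has_integral L) {a..}"
  unfolding has_integral_alt'
proof (intro conjI allI impI)
  have Int: "{a..} \<inter> cbox p q = {max a p..q}" for p q :: real by auto
  have sub: "f integrable_on {max a p..q}" for p q
    using int[of q] by (rule integrable_on_subinterval) auto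
  show "(\<lambda>x. if x \<in> {a..} then f x else 0) integrable_on cbox p q" for p q
    using sub[of p q] unfolding integrable_restrict_Int Int .
  fix e :: real assume "e > 0"
  then obtain R0 where R0: "\<And>R. R \<ge> R0 \<Longrightarrow> dist (integral {a..R} f) L < e"
    using lim unfolding tendsto_iff eventually_at_top_linorder by blast
  show "\<exists>B>0. \<forall>p q. ball 0 B \<subseteq> cbox p q \<longrightarrow>
      norm (integral (cbox p q) (\<lambda>x. if x \<in> {a..} then f x else 0) - L) < e"
  \<comment> \<open>A box containing this ball reaches left of a and right of R0, so restriction to
    the half-line leaves an integral from a to some q \<ge> R0.\<close>
  proof (intro exI[of _ "\<bar>R0\<bar> + \<bar>a\<bar> + 1"] conjI allI impI)
    fix p q :: real assume sub: "ball 0 (\<bar>R0\<bar> + \<bar>a\<bar> + 1) \<subseteq> cbox p q"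
    have "\<bar>R0\<bar> + \<bar>a\<bar> \<in> ball 0 (\<bar>R0\<bar> + \<bar>a\<bar> + 1)" "- (\<bar>R0\<bar> + \<bar>a\<bar>) \<in> ball 0 (\<bar>R0\<bar> + \<bar>a\<bar> + 1)"
      by (auto simp: dist_real_def)
    then have "\<bar>R0\<bar> + \<bar>a\<bar> \<in> cbox p q" "- (\<bar>R0\<bar> + \<bar>a\<bar>) \<in> cbox p q"
      using sub by blast+
    then have pq: "p \<le> a" "R0 \<le> q" by auto
    have "integral (cbox p q) (\<lambda>x. if x \<in> {a..} then f x else 0) = integral {a..q} f"
      unfolding integral_restrict_Int Int using pq by (simp add: max_absorb1)
    then show "norm (integral (cbox p q) (\<lambda>x. if x \<in> {a..} then f x else 0) - L) < e"
      using R0[OF pq(2)] by (simp add: dist_norm)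
  qed auto
qed

section \<open>Abel's theorem for the Gaussian weight\<close>

text \<open>The second mean value theorem gives g(a) times an integral bounded by D plus g(b) times
  a difference of two such integrals: at most (1 + 2) g(b) D. The bound sees only primitives of f,
  so cancellation is preserved.\<close>

lemma increasing_weight_integral_bound:
  fixes f g :: "real \<Rightarrow> real"
  assumes f: "f integrable_on {a..b}" and ab: "a \<le> b"
    and mono: "\<And>x y. a \<le> x \<Longrightarrow> x \<le> y \<Longrightarrow> y \<le> b \<Longrightarrow> g x \<le> g y" and pos: "g a \<ge> 0"
    and D: "\<And>c. c \<in> {a..b} \<Longrightarrow> \<bar>integral {a..c} f\<bar> \<le> D"
  shows "(\<lambda>x. g x * f x) integrable_on {a..b}"
    and "\<bar>integral {a..b} (\<lambda>x. g x * f x)\<bar> \<le> 3 * g b * D"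
proof -
  obtain c where c: "c \<in> {a..b}"
    and I: "((\<lambda>x. g x * f x) has_integral (g a * integral {a..c} f + g b * integral {c..b} f)) {a..b}"
    using second_mean_value_theorem_full[OF f ab, of g] mono by blast
  show "(\<lambda>x. g x * f x) integrable_on {a..b}" using I by blast
  have gab: "g a \<le> g b" using mono[of a b] ab by simp
  have "integral {a..c} f + integral {c..b} f = integral {a..b} f"
    using c f by (intro Henstock_Kurzweil_Integration.integral_combine) auto
  then have cb: "\<bar>integral {c..b} f\<bar> \<le> 2 * D"
    using D[OF c] D[of b] ab by auto
  have D0: "D \<ge> 0" using D[OF c] by linarith
  have "\<bar>g a * integral {a..c} f\<bar> \<le> g b * D"
    unfolding abs_mult using gab pos D[OF c] D0 by (intro mult_mono) auto
  moreover have "\<bar>g b * integral {c..b} f\<bar> \<le> g b * (2 * D)"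
    unfolding abs_mult using gab pos cb by (intro mult_mono) auto
  ultimately show "\<bar>integral {a..b} (\<lambda>x. g x * f x)\<bar> \<le> 3 * g b * D"
    using integral_unique[OF I] by linarith
qed

text \<open>Without absolute integrability of f dominated convergence is out of reach. Instead the
  error is estimated on [0, S] by a bound free of S, with S then sent to infinity.\<close>

lemma abelian_gaussian:
  fixes f :: "real \<Rightarrow> real"
  assumes int: "\<And>R. f integrable_on {0..R}"
    and lim: "((\<lambda>R. integral {0..R} f) \<longlongrightarrow> L) at_top"
    and ai: "\<And>\<epsilon>. \<epsilon> > 0 \<Longrightarrow> (\<lambda>a. exp (- \<epsilon> * a\<^sup>2) * f a) absolutely_integrable_on {0..}"
  shows "((\<lambda>\<epsilon>. integral {0..} (\<lambda>a. exp (- \<epsilon> * a\<^sup>2) * f a)) \<longlongrightarrow> L) (at_right 0)"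
proof (rule tendstoI)
  fix e :: real assume e: "e > 0"
  \<comment> \<open>After \<epsilon> tends to 0 the bound is 7 \<delta>: 6 \<delta> from the tail
    beyond R and \<delta> from the distance of a partial integral to L.\<close>
  define \<delta> where "\<delta> = e / 16"
  have \<delta>: "\<delta> > 0" using e by (simp add: \<delta>_def)
  obtain R0 where R0: "\<And>R. R \<ge> R0 \<Longrightarrow> dist (integral {0..R} f) L < \<delta>"
    using lim \<delta> unfolding tendsto_iff eventually_at_top_linorder by blast
  define R where "R = max R0 0"
  have R: "R \<ge> 0" and far: "\<And>S. S \<ge> R \<Longrightarrow> \<bar>integral {0..S} f - L\<bar> < \<delta>"
    using R0 by (auto simp: R_def dist_real_def)
  have "bounded ((\<lambda>x. integral {0..x} f) ` {0..R})"
    by (intro compact_imp_bounded compact_continuous_image indefinite_integral_continuous_1 int) auto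
  then obtain D where D: "\<And>c. c \<in> {0..R} \<Longrightarrow> \<bar>integral {0..c} f\<bar> \<le> D"
    unfolding bounded_iff by fastforce
  have D0: "D \<ge> 0" using D[of 0] R by simp
  have near: "\<bar>integral {0..} (\<lambda>a. exp (- \<epsilon> * a\<^sup>2) * f a) - L\<bar> \<le> 3 * (1 - exp (- \<epsilon> * R\<^sup>2)) * D + 7 * \<delta>"
    if \<epsilon>: "\<epsilon> > 0" for \<epsilon>
  proof -
    \<comment> \<open>The error has weight 1 - exp (-\<epsilon> a^2), nonnegative and increasing as
      the mean value estimate requires. On [0, R] it is at most g R, which vanishes with \<epsilon>;
      beyond R it is at most 1, and the primitives of f are small.\<close>
    define g where "g a = 1 - exp (- \<epsilon> * a\<^sup>2)" for a :: real
    have mono: "g a \<le> g b" if "0 \<le> a" "a \<le> b" for a b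
      using that \<epsilon> by (simp add: g_def power_mono)
    have g0: "0 \<le> g a" "g a \<le> 1" for a
      using \<epsilon> by (auto simp: g_def)
    have "\<bar>integral {0..S} (\<lambda>a. exp (- \<epsilon> * a\<^sup>2) * f a) - L\<bar> \<le> 3 * g R * D + 7 * \<delta>" if S: "S \<ge> R" for S
    proof -
      have i0: "f integrable_on {0..R}" by (rule int)
      have i1: "f integrable_on {R..S}"
        using int[of S] by (rule integrable_on_subinterval) (use R in auto)
      have fin: "\<bar>integral {R..c} f\<bar> \<le> 2 * \<delta>" if "c \<in> {R..S}" for c
      proof -
        have "integral {0..R} f + integral {R..c} f = integral {0..c} f"
          using that R by (intro Henstock_Kurzweil_Integration.integral_combine int) auto
        then show ?thesis using far[of R] far[of c] that by auto
      qed
      note b0 = increasing_weight_integral_bound[OF i0 R _ _ D, of g]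
      note b1 = increasing_weight_integral_bound[OF i1 S _ _ fin, of g]
      have B0: "(\<lambda>x. g x * f x) integrable_on {0..R}" "\<bar>integral {0..R} (\<lambda>x. g x * f x)\<bar> \<le> 3 * g R * D"
        using b0 mono g0 by auto
      have B1: "(\<lambda>x. g x * f x) integrable_on {R..S}" "\<bar>integral {R..S} (\<lambda>x. g x * f x)\<bar> \<le> 3 * g S * (2 * \<delta>)"
        using b1 mono g0 R by auto
      have "g S * (6 * \<delta>) \<le> 1 * (6 * \<delta>)"
        using g0 \<delta> by (intro mult_right_mono) auto
      then have B1': "\<bar>integral {R..S} (\<lambda>x. g x * f x)\<bar> \<le> 6 * \<delta>"
        using B1(2) by linarith
      have gi: "(\<lambda>x. g x * f x) integrable_on {0..S}"
        by (rule Henstock_Kurzweil_Integration.integrable_combine[OF R S B0(1) B1(1)])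
      have "integral {0..R} (\<lambda>x. g x * f x) + integral {R..S} (\<lambda>x. g x * f x) = integral {0..S} (\<lambda>x. g x * f x)"
        using R S gi by (rule Henstock_Kurzweil_Integration.integral_combine)
      then have gB: "\<bar>integral {0..S} (\<lambda>x. g x * f x)\<bar> \<le> 3 * g R * D + 6 * \<delta>"
        using B0(2) B1' by linarith
      have "(\<lambda>a. exp (- \<epsilon> * a\<^sup>2) * f a) = (\<lambda>a. f a - g a * f a)"
        by (simp add: g_def algebra_simps)
      then have "integral {0..S} (\<lambda>a. exp (- \<epsilon> * a\<^sup>2) * f a) = integral {0..S} f - integral {0..S} (\<lambda>x. g x * f x)"
        using Henstock_Kurzweil_Integration.integral_diff[OF int[of S] gi] by simp
      then show ?thesis using gB far[OF S] by linarith
    qed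
    then have "eventually (\<lambda>S. \<bar>integral {0..S} (\<lambda>a. exp (- \<epsilon> * a\<^sup>2) * f a) - L\<bar> \<le> 3 * g R * D + 7 * \<delta>) at_top"
      using eventually_ge_at_top[of R] by (rule eventually_mono[rotated])
    moreover have "((\<lambda>S. \<bar>integral {0..S} (\<lambda>a. exp (- \<epsilon> * a\<^sup>2) * f a) - L\<bar>) \<longlongrightarrow>
        \<bar>integral {0..} (\<lambda>a. exp (- \<epsilon> * a\<^sup>2) * f a) - L\<bar>) at_top"
      by (intro tendsto_intros tendsto_integral_at_top_absolutely_integrable ai \<epsilon>)
    ultimately show ?thesis
      unfolding g_def by (intro tendsto_upperbound) auto
  qed
  have "((\<lambda>\<epsilon>. 3 * (1 - exp (- \<epsilon> * R\<^sup>2)) * D + 7 * \<delta>) \<longlongrightarrow> 3 * (1 - exp (- 0 * R\<^sup>2)) * D + 7 * \<delta>) (at_right (0::real))"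
    by (intro tendsto_intros)
  then have "eventually (\<lambda>\<epsilon>. 3 * (1 - exp (- \<epsilon> * R\<^sup>2)) * D + 7 * \<delta> < e) (at_right (0::real))"
    by (rule order_tendstoD) (use e in \<open>simp add: \<delta>_def\<close>)
  then show "eventually (\<lambda>\<epsilon>. dist (integral {0..} (\<lambda>a. exp (- \<epsilon> * a\<^sup>2) * f a)) L < e) (at_right 0)"
    using eventually_at_right_less[of 0]
    by eventually_elim (use near in \<open>fastforce simp: dist_real_def\<close>)
qed

section \<open>Decay and conditional convergence of the integral\<close>

lemma real_J_decay_powr:
  assumes x: "x > 0"
  obtains C where "\<And>a. a \<ge> 1 / x \<Longrightarrow> \<bar>real_J \<nu> (a * x)\<bar> \<le> C * a powr (- 1 / 2)"
    and "C \<ge> 0"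
proof -
  obtain C where C: "\<And>t. t \<ge> 1 \<Longrightarrow> \<bar>real_J \<nu> t\<bar> \<le> C / sqrt t"
    using real_J_decay by blast
  have C0: "C \<ge> 0" using C[of 1] by simp
  have "\<bar>real_J \<nu> (a * x)\<bar> \<le> C / sqrt x * a powr (- 1 / 2)" if "a \<ge> 1 / x" for a
  proof -
    have a: "a > 0" using that x zero_less_divide_1_iff[of x] by linarith
    have "a * x \<ge> 1" using that x by (simp add: divide_le_eq)
    then have "\<bar>real_J \<nu> (a * x)\<bar> \<le> C / sqrt (a * x)" by (rule C)
    also have "\<dots> = C / sqrt x * (1 / sqrt a)" by (simp add: real_sqrt_mult)
    also have "1 / sqrt a = a powr (- 1 / 2)"
      using a powr_half_sqrt[of a] by (simp add: powr_minus_divide)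
    finally show ?thesis .
  qed
  moreover have "C / sqrt x \<ge> 0" using C0 x by simp
  ultimately show ?thesis by (rule that)
qed

lemma square_J_decay_powr:
  obtains C where "\<And>a. a \<ge> 1 \<Longrightarrow> \<bar>square_J \<nu> a\<bar> \<le> C * a powr (- 1)" and "C \<ge> 0"
proof -
  obtain C where C: "\<And>t. t \<ge> 1 \<Longrightarrow> \<bar>real_J \<nu> t\<bar> \<le> C / sqrt t"
    using real_J_decay by blast
  have "\<bar>square_J \<nu> a\<bar> \<le> C * a powr (- 1)" if "a \<ge> 1" for a
    using C[of "a\<^sup>2"] that by (simp add: square_J_def powr_minus_divide one_le_power)
  moreover have "C \<ge> 0" using C[of 1] by simp
  ultimately show ?thesis by (rule that)
qed

text \<open>Up to a lower-order term, 2 a J_\<mu>(a^2) is the derivative of J_{\<mu>+1}(a^2). Each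
  integration by parts thus trades a factor a for a higher order.\<close>

lemma has_field_derivative_square_J_Suc:
  assumes a: "a > 0"
  shows "(square_J (\<mu> + 1) has_field_derivative
    2 * a * square_J \<mu> a - 2 * (\<mu> + 1) / a * square_J (\<mu> + 1) a) (at a)"
proof -
  have "((\<lambda>a. a\<^sup>2) has_field_derivative 2 * a) (at a)"
    by (auto intro!: derivative_eq_intros)
  from DERIV_chain2[OF has_field_derivative_real_J_Suc this, of \<mu>] a
  have "(square_J (\<mu> + 1) has_field_derivative
      (real_J \<mu> (a\<^sup>2) - (\<mu> + 1) / a\<^sup>2 * real_J (\<mu> + 1) (a\<^sup>2)) * (2 * a)) (at a)"
    by (simp add: square_J_def [abs_def])
  then show ?thesis
    by (rule DERIV_cong) (use a in \<open>simp add: square_J_def field_simps power2_eq_square\<close>)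
qed

text \<open>
  Two integrations by parts against \<open>a\<^sup>2 J\<^sub>\<mu>(a\<^sup>2)\<close>, with remainder \<open>O(a\<^sup>-\<^sup>3\<^sup>/\<^sup>2)\<close>.
\<close>
lemma integrand_primitive:
  fixes x \<kappa> \<mu> :: real
  assumes x: "x > 0" and a: "a > 0"
  shows "((\<lambda>a. 1 / 2 * a * square_J (\<mu> + 1) a * real_J \<kappa> (a * x)
            + x / 4 * square_J (\<mu> + 2) a * real_J (\<kappa> + 1) (a * x)) has_field_derivative
     (a\<^sup>2 * real_J \<kappa> (a * x) * square_J \<mu> a
       - ((\<mu> + 1 / 2 - \<kappa> / 2) * square_J (\<mu> + 1) a * real_J \<kappa> (a * x)
         + x / 2 * ((\<mu> + 2 + (\<kappa> + 1) / 2) / a * square_J (\<mu> + 2) a * real_J (\<kappa> + 1) (a * x)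
              - x / 2 * square_J (\<mu> + 2) a * real_J \<kappa> (a * x))))) (at a)"
proof -
  define u where "u a = real_J \<kappa> (a * x)" for a
  define w where "w a = real_J (\<kappa> + 1) (a * x)" for a
  define v1 where "v1 = square_J (\<mu> + 1)"
  define v2 where "v2 = square_J (\<mu> + 2)"
  have l: "((\<lambda>a. a * x) has_field_derivative x) (at a)"
    by (auto intro!: derivative_eq_intros)
  have ax: "a * x > 0" using a x by simp
  have du: "(u has_field_derivative (\<kappa> / (a * x) * u a - w a) * x) (at a)"
    using DERIV_chain2[OF has_field_derivative_real_J[OF ax] l, of \<kappa>] by (simp add: u_def [abs_def] w_def)
  have dw: "(w has_field_derivative (u a - (\<kappa> + 1) / (a * x) * w a) * x) (at a)"
    using DERIV_chain2[OF has_field_derivative_real_J_Suc[OF ax] l, of \<kappa>] by (simp add: u_def w_def [abs_def])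
  have d1: "(v1 has_field_derivative 2 * a * square_J \<mu> a - 2 * (\<mu> + 1) / a * v1 a) (at a)"
    unfolding v1_def by (rule has_field_derivative_square_J_Suc[OF a])
  have d2: "(v2 has_field_derivative 2 * a * v1 a - 2 * (\<mu> + 2) / a * v2 a) (at a)"
    using has_field_derivative_square_J_Suc[OF a, of "\<mu> + 1"] by (simp add: v1_def v2_def add.assoc)
  have d0: "((\<lambda>a. 1 / 2 * a) has_field_derivative 1 / 2) (at a)"
    by (auto intro!: derivative_eq_intros)
  have "((\<lambda>a. 1 / 2 * a * v1 a * u a + x / 4 * v2 a * w a) has_field_derivative
     (a\<^sup>2 * u a * square_J \<mu> a
       - ((\<mu> + 1 / 2 - \<kappa> / 2) * v1 a * u a
         + x / 2 * ((\<mu> + 2 + (\<kappa> + 1) / 2) / a * v2 a * w a - x / 2 * v2 a * u a)))) (at a)"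
    by (rule DERIV_cong[OF DERIV_add[OF DERIV_mult[OF DERIV_mult[OF d0 d1] du]
          DERIV_mult[OF DERIV_cmult[OF d2] dw]]])
      (use a x in \<open>simp add: field_simps power2_eq_square\<close>)
  then show ?thesis
    unfolding u_def w_def v1_def v2_def .
qed

text \<open>The integrand itself is only O(a^(1/2)). The primitive G is O(a^(-1/2)) and the
  remainder r is O(a^(-3/2)), so G R tends to 0 and r is absolutely integrable from b on.\<close>

lemma integrand_integral_convergent:
  fixes x \<kappa> \<mu> :: real
  assumes x: "x > 0"
    and int: "\<And>R. (\<lambda>a. a\<^sup>2 * real_J \<kappa> (a * x) * square_J \<mu> a) integrable_on {0..R}"
  shows "\<exists>L. ((\<lambda>R. integral {0..R} (\<lambda>a. a\<^sup>2 * real_J \<kappa> (a * x) * square_J \<mu> a)) \<longlongrightarrow> L) at_top"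
proof -
  define f where "f a = a\<^sup>2 * real_J \<kappa> (a * x) * square_J \<mu> a" for a
  define G where "G a = 1 / 2 * a * square_J (\<mu> + 1) a * real_J \<kappa> (a * x)
            + x / 4 * square_J (\<mu> + 2) a * real_J (\<kappa> + 1) (a * x)" for a
  define r where "r a = (\<mu> + 1 / 2 - \<kappa> / 2) * square_J (\<mu> + 1) a * real_J \<kappa> (a * x)
         + x / 2 * ((\<mu> + 2 + (\<kappa> + 1) / 2) / a * square_J (\<mu> + 2) a * real_J (\<kappa> + 1) (a * x)
              - x / 2 * square_J (\<mu> + 2) a * real_J \<kappa> (a * x))" for a
  have dG: "(G has_field_derivative f a - r a) (at a)" if "a > 0" for a
    unfolding G_def [abs_def] f_def r_def by (rule integrand_primitive[OF x that])
  \<comment> \<open>From b on both a \<ge> 1 and a x \<ge> 1, so all decay estimates hold.\<close>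
  define b where "b = max 1 (1 / x)"
  have b: "b \<ge> 1" "b \<ge> 1 / x" by (auto simp: b_def)
  obtain Cu where Cu: "\<And>a. a \<ge> 1 / x \<Longrightarrow> \<bar>real_J \<kappa> (a * x)\<bar> \<le> Cu * a powr (- 1 / 2)" "Cu \<ge> 0"
    using real_J_decay_powr[OF x] by blast
  obtain Cw where Cw: "\<And>a. a \<ge> 1 / x \<Longrightarrow> \<bar>real_J (\<kappa> + 1) (a * x)\<bar> \<le> Cw * a powr (- 1 / 2)" "Cw \<ge> 0"
    using real_J_decay_powr[OF x] by blast
  obtain C1 where C1: "\<And>a. a \<ge> 1 \<Longrightarrow> \<bar>square_J (\<mu> + 1) a\<bar> \<le> C1 * a powr (- 1)" "C1 \<ge> 0"
    using square_J_decay_powr by blast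
  obtain C2 where C2: "\<And>a. a \<ge> 1 \<Longrightarrow> \<bar>square_J (\<mu> + 2) a\<bar> \<le> C2 * a powr (- 1)" "C2 \<ge> 0"
    using square_J_decay_powr by blast
  have prod: "\<bar>c * v * u\<bar> \<le> \<bar>c\<bar> * (C * D) * a powr (- 3 / 2)"
    if "\<bar>v\<bar> \<le> C * a powr (- 1)" "\<bar>u\<bar> \<le> D * a powr (- 1 / 2)" "C \<ge> 0" "D \<ge> 0" for c u v C D a :: real
  proof -
    have "\<bar>v\<bar> * \<bar>u\<bar> \<le> (C * a powr (- 1)) * (D * a powr (- 1 / 2))"
      using that by (intro mult_mono) auto
    also have "\<dots> = C * D * (a powr (- 1) * a powr (- 1 / 2))" by (simp only: mult_ac)
    also have "a powr (- 1) * a powr (- 1 / 2) = a powr (- 3 / 2)"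
      unfolding powr_add[symmetric] by simp
    finally have "\<bar>c\<bar> * (\<bar>v\<bar> * \<bar>u\<bar>) \<le> \<bar>c\<bar> * (C * D * a powr (- 3 / 2))"
      by (rule mult_left_mono) simp
    then show ?thesis by (simp add: abs_mult mult.assoc)
  qed
  have p1: "\<bar>c * square_J (\<mu> + 1) a * real_J \<kappa> (a * x)\<bar> \<le> \<bar>c\<bar> * (C1 * Cu) * a powr (- 3 / 2)"
    and p2: "\<bar>c * square_J (\<mu> + 2) a * real_J (\<kappa> + 1) (a * x)\<bar> \<le> \<bar>c\<bar> * (C2 * Cw) * a powr (- 3 / 2)"
    and p3: "\<bar>c * square_J (\<mu> + 2) a * real_J \<kappa> (a * x)\<bar> \<le> \<bar>c\<bar> * (C2 * Cu) * a powr (- 3 / 2)"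
    if "a \<ge> b" for a c
  proof -
    have a: "a \<ge> 1" "a \<ge> 1 / x" using that b by linarith+
    note Cu' = Cu(1)[OF a(2)] and Cw' = Cw(1)[OF a(2)] and C1' = C1(1)[OF a(1)] and C2' = C2(1)[OF a(1)]
    show "\<bar>c * square_J (\<mu> + 1) a * real_J \<kappa> (a * x)\<bar> \<le> \<bar>c\<bar> * (C1 * Cu) * a powr (- 3 / 2)"
      by (rule prod[OF C1' Cu' C1(2) Cu(2)])
    show "\<bar>c * square_J (\<mu> + 2) a * real_J (\<kappa> + 1) (a * x)\<bar> \<le> \<bar>c\<bar> * (C2 * Cw) * a powr (- 3 / 2)"
      by (rule prod[OF C2' Cw' C2(2) Cw(2)])
    show "\<bar>c * square_J (\<mu> + 2) a * real_J \<kappa> (a * x)\<bar> \<le> \<bar>c\<bar> * (C2 * Cu) * a powr (- 3 / 2)"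
      by (rule prod[OF C2' Cu' C2(2) Cu(2)])
  qed
  define D where "D = \<bar>\<mu> + 1 / 2 - \<kappa> / 2\<bar> * (C1 * Cu) + x / 2 * (\<bar>\<mu> + 2 + (\<kappa> + 1) / 2\<bar> * (C2 * Cw) + x / 2 * (C2 * Cu))"
  have rb: "\<bar>r a\<bar> \<le> D * a powr (- 3 / 2)" if a: "a \<ge> b" for a
  proof -
    define P where "P = a powr (- 3 / 2)"
    define c where "c = \<mu> + 2 + (\<kappa> + 1) / 2"
    define A1 where "A1 = (\<mu> + 1 / 2 - \<kappa> / 2) * square_J (\<mu> + 1) a * real_J \<kappa> (a * x)"
    define A2 where "A2 = c / a * square_J (\<mu> + 2) a * real_J (\<kappa> + 1) (a * x)"
    define A3 where "A3 = x / 2 * square_J (\<mu> + 2) a * real_J \<kappa> (a * x)"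
    have a1: "a \<ge> 1" using a b by simp
    have P: "P \<ge> 0" by (simp add: P_def)
    have B1: "\<bar>A1\<bar> \<le> \<bar>\<mu> + 1 / 2 - \<kappa> / 2\<bar> * (C1 * Cu) * P"
      unfolding A1_def P_def by (rule p1[OF a])
    \<comment> \<open>The additional decay 1/a of \<open>A2\<close> is given away, so that all three
      parts share the power -3/2.\<close>
    have "\<bar>c / a\<bar> \<le> \<bar>c\<bar>" using a1 by (simp add: divide_le_eq mult_left_mono[of 1 a "\<bar>c\<bar>", simplified])
    then have "\<bar>c / a\<bar> * (C2 * Cw * P) \<le> \<bar>c\<bar> * (C2 * Cw * P)"
      using C2(2) Cw(2) P by (intro mult_right_mono) auto
    moreover have "\<bar>A2\<bar> \<le> \<bar>c / a\<bar> * (C2 * Cw) * P"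
      unfolding A2_def P_def by (rule p2[OF a])
    ultimately have B2: "\<bar>A2\<bar> \<le> \<bar>c\<bar> * (C2 * Cw) * P"
      by (simp only: mult.assoc)
    have B3: "\<bar>A3\<bar> \<le> x / 2 * (C2 * Cu) * P"
      using p3[OF a, of "x / 2"] x unfolding A3_def P_def by simp
    have "\<bar>A2 - A3\<bar> \<le> \<bar>c\<bar> * (C2 * Cw) * P + x / 2 * (C2 * Cu) * P"
      using B2 B3 by linarith
    then have "x / 2 * \<bar>A2 - A3\<bar> \<le> x / 2 * (\<bar>c\<bar> * (C2 * Cw) * P + x / 2 * (C2 * Cu) * P)"
      using x by (intro mult_left_mono) auto
    moreover have "\<bar>x / 2 * (A2 - A3)\<bar> = x / 2 * \<bar>A2 - A3\<bar>"
      using x by (simp add: abs_mult)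
    moreover have "r a = A1 + x / 2 * (A2 - A3)"
      unfolding r_def A1_def A2_def A3_def c_def ..
    ultimately have "\<bar>r a\<bar> \<le> \<bar>\<mu> + 1 / 2 - \<kappa> / 2\<bar> * (C1 * Cu) * P + x / 2 * (\<bar>c\<bar> * (C2 * Cw) * P + x / 2 * (C2 * Cu) * P)"
      using B1 by linarith
    also have "\<dots> = D * P"
      unfolding D_def c_def by (simp only: distrib_left distrib_right mult.assoc)
    finally show ?thesis unfolding P_def .
  qed
  have cont_u: "continuous_on {b..} (\<lambda>a. real_J \<beta> (a * x))" for \<beta>
    using b x by (intro continuous_on_compose2[OF continuous_on_real_J] continuous_intros) auto
  have cont_v: "continuous_on {b..} (square_J \<beta>)" for \<beta>
    using b by (intro continuous_on_subset[OF continuous_on_square_J]) auto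
  have "continuous_on {b..} r"
    unfolding r_def [abs_def] using b by (intro continuous_intros cont_u cont_v) auto
  then have "r \<in> borel_measurable (lebesgue_on {b..})"
    by (rule continuous_imp_measurable_on_sets_lebesgue) simp
  moreover have "(\<lambda>a. D * a powr (- 3 / 2)) integrable_on {b..}"
  proof -
    have "((\<lambda>a. a powr (- 3 / 2)) has_integral - (b powr (- 3 / 2 + 1)) / (- 3 / 2 + 1)) {b..}"
      by (rule has_integral_powr_to_inf) (use b in auto)
    then show ?thesis
      by (intro has_integral_integrable[OF has_integral_mult_right])
  qed
  ultimately have rai: "r absolutely_integrable_on {b..}"
    by (intro measurable_bounded_by_integrable_imp_absolutely_integrable[where g = "\<lambda>a. D * a powr (- 3 / 2)"])
      (use rb in auto)
  have rlim: "((\<lambda>R. integral {b..R} r) \<longlongrightarrow> integral {b..} r) at_top"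
    by (rule tendsto_integral_at_top_absolutely_integrable[OF rai])
  have "(G \<longlongrightarrow> 0) at_top"
  proof (rule Lim_null_comparison)
    define E where "E = 1 / 2 * (C1 * Cu) + x / 4 * (C2 * Cw)"
    show "eventually (\<lambda>a. norm (G a) \<le> E * a powr (- 1 / 2)) at_top"
      using eventually_ge_at_top[of b]
    proof (rule eventually_mono)
      fix a assume a: "a \<ge> b"
      have a1: "a \<ge> 1" using a b by simp
      define P where "P = a powr (- 3 / 2)"
      have P: "P \<ge> 0" by (simp add: P_def)
      have aP: "a * P = a powr (- 1 / 2)"
        using a1 powr_mult_base[of a "- 3 / 2"] by (simp add: P_def)
      have "\<bar>1 / 2 * a * square_J (\<mu> + 1) a * real_J \<kappa> (a * x)\<bar> \<le> \<bar>1 / 2 * a\<bar> * (C1 * Cu) * P"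
        unfolding P_def by (rule p1[OF a])
      also have "\<dots> = 1 / 2 * (C1 * Cu) * (a * P)" using a1 by simp
      finally have B1: "\<bar>1 / 2 * a * square_J (\<mu> + 1) a * real_J \<kappa> (a * x)\<bar> \<le> 1 / 2 * (C1 * Cu) * (a * P)" .
      have "\<bar>x / 4 * square_J (\<mu> + 2) a * real_J (\<kappa> + 1) (a * x)\<bar> \<le> \<bar>x / 4\<bar> * (C2 * Cw) * P"
        unfolding P_def by (rule p2[OF a])
      also have "\<dots> \<le> \<bar>x / 4\<bar> * (C2 * Cw) * (a * P)"
        using a1 P C2(2) Cw(2) mult_right_mono[of 1 a P] by (intro mult_left_mono) auto
      finally have B2: "\<bar>x / 4 * square_J (\<mu> + 2) a * real_J (\<kappa> + 1) (a * x)\<bar> \<le> x / 4 * (C2 * Cw) * (a * P)"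
        using x by simp
      have "norm (G a) \<le> 1 / 2 * (C1 * Cu) * (a * P) + x / 4 * (C2 * Cw) * (a * P)"
        unfolding G_def real_norm_def using B1 B2 by linarith
      also have "\<dots> = E * (a * P)" unfolding E_def by (simp only: distrib_right)
      finally show "norm (G a) \<le> E * a powr (- 1 / 2)" unfolding aP .
    qed
    have "((\<lambda>a::real. a powr (- 1 / 2)) \<longlongrightarrow> 0) at_top"
      using tendsto_neg_powr[of "- 1 / 2", OF _ filterlim_ident] by simp
    then show "((\<lambda>a. E * a powr (- 1 / 2)) \<longlongrightarrow> 0) at_top"
      by (rule tendsto_mult_right_zero)
  qed
  then have "((\<lambda>R. integral {0..b} f + (G R - G b + integral {b..R} r)) \<longlongrightarrow>
      integral {0..b} f + (0 - G b + integral {b..} r)) at_top"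
    by (intro tendsto_intros rlim)
  moreover have "eventually (\<lambda>R. integral {0..b} f + (G R - G b + integral {b..R} r) = integral {0..R} f) at_top"
    using eventually_ge_at_top[of b]
  proof (rule eventually_mono)
    fix R assume R: "R \<ge> b"
    have "((\<lambda>a. f a - r a) has_integral (G R - G b)) {b..R}"
    proof (rule fundamental_theorem_of_calculus[OF R])
      fix a assume "a \<in> {b..R}"
      then have "a > 0" using b by simp
      then show "(G has_vector_derivative f a - r a) (at a within {b..R})"
        unfolding has_real_derivative_iff_has_vector_derivative[symmetric]
        by (rule has_field_derivative_at_within[OF dG])
    qed
    moreover have "r integrable_on {b..R}"
      using set_lebesgue_integral_eq_integral(1)[OF rai] by (rule integrable_on_subinterval) auto
    ultimately have "((\<lambda>a. (f a - r a) + r a) has_integral (G R - G b + integral {b..R} r)) {b..R}"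
      by (intro has_integral_add integrable_integral)
    then have "integral {b..R} f = G R - G b + integral {b..R} r"
      by (simp add: integral_unique)
    moreover have "integral {0..b} f + integral {b..R} f = integral {0..R} f"
      using b R int[of R] by (intro Henstock_Kurzweil_Integration.integral_combine) (auto simp: f_def [abs_def])
    ultimately show "integral {0..b} f + (G R - G b + integral {b..R} r) = integral {0..R} f"
      by simp
  qed
  ultimately have "((\<lambda>R. integral {0..R} f) \<longlongrightarrow> integral {0..b} f + (0 - G b + integral {b..} r)) at_top"
    by (rule Lim_transform_eventually)
  then show ?thesis unfolding f_def [abs_def] by blast
qed

text \<open>Convergence of the partial integrals yields some L; Abel's theorem makes L the Abel
  value, and uniqueness of limits forces V = L.\<close>

lemma has_integral_bessel_integrand_of_real:
  fixes x \<nu> :: real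
  assumes \<nu>: "\<nu> \<ge> - 1 / 4" and x: "x > 0"
    and abel: "has_abel_integral (bessel_integrand \<nu> (of_real x)) V"
  shows "(bessel_integrand \<nu> (of_real x) has_integral V) {0..}"
proof -
  define f where "f a = a\<^sup>2 * real_J (2 * \<nu>) (a * x) * square_J (\<nu> + 1 / 2) a" for a
  have eq: "bessel_integrand \<nu> (of_real x) a = of_real (f a)" if "a \<ge> 0" for a
  \<comment> \<open>At a = 0 the factor a^2 hides the different conventions of
    \<open>bessel_J\<close> and \<open>real_J\<close> at the origin.\<close>
  proof (cases "a = 0")
    case False
    then have a: "a > 0" using that by simp
    then have "bessel_J (2 * \<nu>) (of_real (a * x)) = of_real (real_J (2 * \<nu>) (a * x))"
      using x by (intro bessel_J_of_real) simp
    moreover have "bessel_J (\<nu> + 1 / 2) (of_real (a\<^sup>2)) = of_real (real_J (\<nu> + 1 / 2) (a\<^sup>2))"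
      using a by (intro bessel_J_of_real) simp
    ultimately show ?thesis
      unfolding bessel_integrand_def f_def square_J_def by (simp only: of_real_mult)
  qed (simp add: bessel_integrand_def f_def)
  have eq': "exp (- \<epsilon> * a\<^sup>2) *\<^sub>R bessel_integrand \<nu> (of_real x) a = complex_of_real (exp (- \<epsilon> * a\<^sup>2) * f a)"
    if "a \<in> {0..}" for a \<epsilon>
    using eq[of a] that by (simp add: scaleR_conv_of_real)
  have ai: "(\<lambda>a. exp (- \<epsilon> * a\<^sup>2) * f a) absolutely_integrable_on {0..}" if "\<epsilon> > 0" for \<epsilon>
  proof -
    have "(\<lambda>a. exp (- \<epsilon> * a\<^sup>2) *\<^sub>R bessel_integrand \<nu> (of_real x) a) absolutely_integrable_on {0..}"
      using abel that unfolding has_abel_integral_def by blast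
    moreover have "(\<lambda>a. exp (- \<epsilon> * a\<^sup>2) *\<^sub>R bessel_integrand \<nu> (of_real x) a) absolutely_integrable_on {0..} \<longleftrightarrow>
        (\<lambda>a. complex_of_real (exp (- \<epsilon> * a\<^sup>2) * f a)) absolutely_integrable_on {0..}"
      by (rule set_integrable_cong[OF refl refl eq'])
    ultimately have "integrable (lebesgue_on {0..}) (\<lambda>a. complex_of_real (exp (- \<epsilon> * a\<^sup>2) * f a))"
      by (simp only: absolutely_integrable_iff_lebesgue_on[of "{0..}"] simp_thms) (simp add: absolutely_integrable_iff_lebesgue_on)
    then show ?thesis
      unfolding complex_of_real_integrable_eq by (simp add: absolutely_integrable_iff_lebesgue_on)
  qed
  \<comment> \<open>The integrand weighted with \<epsilon> = 1 is integrable, and exp (a^2) is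
    bounded on [0, R]; multiplying back avoids a separate study of f near 0.\<close>
  have int: "f integrable_on {0..R}" for R
  proof -
    have "(\<lambda>a. exp (- 1 * a\<^sup>2) * f a) absolutely_integrable_on {0..R}"
      using ai[of 1] by (rule set_integrable_subset) auto
    moreover have cont: "continuous_on {0..R} (\<lambda>a. exp (a\<^sup>2))" by (intro continuous_intros)
    moreover have "(\<lambda>a. exp (a\<^sup>2)) \<in> borel_measurable (lebesgue_on {0..R})"
      by (intro continuous_imp_measurable_on_sets_lebesgue cont) simp
    moreover have "bounded ((\<lambda>a. exp (a\<^sup>2)) ` {0..R})"
      by (intro compact_imp_bounded compact_continuous_image cont) simp
    ultimately have "(\<lambda>a. exp (a\<^sup>2) * (exp (- 1 * a\<^sup>2) * f a)) absolutely_integrable_on {0..R}"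
      using absolutely_integrable_bounded_measurable_product_real[of "\<lambda>a. exp (a\<^sup>2)" "{0..R}"] by simp
    moreover have "exp (a\<^sup>2) * (exp (- 1 * a\<^sup>2) * f a) = f a" for a
      by (simp add: mult.assoc[symmetric] exp_minus)
    ultimately show ?thesis
      by (simp only: set_lebesgue_integral_eq_integral(1))
  qed
  obtain L where L: "((\<lambda>R. integral {0..R} f) \<longlongrightarrow> L) at_top"
    using integrand_integral_convergent[OF x, of "2 * \<nu>" "\<nu> + 1 / 2"] int unfolding f_def [abs_def] by blast
  have "((\<lambda>\<epsilon>. complex_of_real (integral {0..} (\<lambda>a. exp (- \<epsilon> * a\<^sup>2) * f a))) \<longlongrightarrow> of_real L) (at_right 0)"
    by (intro tendsto_of_real abelian_gaussian int L ai)
  moreover have "eventually (\<lambda>\<epsilon>. complex_of_real (integral {0..} (\<lambda>a. exp (- \<epsilon> * a\<^sup>2) * f a))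
      = integral {0..} (\<lambda>a. exp (- \<epsilon> * a\<^sup>2) *\<^sub>R bessel_integrand \<nu> (of_real x) a)) (at_right 0)"
    using eventually_at_right_less[of 0]
  proof (rule eventually_mono)
    fix \<epsilon> :: real assume "0 < \<epsilon>"
    then have "((\<lambda>a. exp (- \<epsilon> * a\<^sup>2) * f a) has_integral integral {0..} (\<lambda>a. exp (- \<epsilon> * a\<^sup>2) * f a)) {0..}"
      by (intro integrable_integral set_lebesgue_integral_eq_integral(1) ai)
    then have "((\<lambda>a. complex_of_real (exp (- \<epsilon> * a\<^sup>2) * f a)) has_integral
        of_real (integral {0..} (\<lambda>a. exp (- \<epsilon> * a\<^sup>2) * f a))) {0..}"
      by (rule has_integral_of_real)
    then have "complex_of_real (integral {0..} (\<lambda>a. exp (- \<epsilon> * a\<^sup>2) * f a))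
        = integral {0..} (\<lambda>a. complex_of_real (exp (- \<epsilon> * a\<^sup>2) * f a))"
      by (rule integral_unique[symmetric])
    also have "\<dots> = integral {0..} (\<lambda>a. exp (- \<epsilon> * a\<^sup>2) *\<^sub>R bessel_integrand \<nu> (of_real x) a)"
      by (rule Henstock_Kurzweil_Integration.integral_cong) (rule eq'[symmetric])
    finally show "complex_of_real (integral {0..} (\<lambda>a. exp (- \<epsilon> * a\<^sup>2) * f a))
      = integral {0..} (\<lambda>a. exp (- \<epsilon> * a\<^sup>2) *\<^sub>R bessel_integrand \<nu> (of_real x) a)" .
  qed
  ultimately have "((\<lambda>\<epsilon>. integral {0..} (\<lambda>a. exp (- \<epsilon> * a\<^sup>2) *\<^sub>R bessel_integrand \<nu> (of_real x) a)) \<longlongrightarrow> of_real L) (at_right 0)"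
    by (rule Lim_transform_eventually)
  moreover have "((\<lambda>\<epsilon>. integral {0..} (\<lambda>a. exp (- \<epsilon> * a\<^sup>2) *\<^sub>R bessel_integrand \<nu> (of_real x) a)) \<longlongrightarrow> V) (at_right 0)"
    using abel unfolding has_abel_integral_def by blast
  ultimately have V: "V = of_real L"
    by (rule tendsto_unique[OF trivial_limit_at_right_real, rotated])
  have "((\<lambda>a. complex_of_real (f a)) has_integral of_real L) {0..}"
    by (intro has_integral_of_real has_integral_atLeast_if_tendsto int L)
  then show ?thesis
    unfolding V by (rule has_integral_eq[rotated]) (simp add: eq)
qed

text \<open>Three readings of the formula: an actual gauge integral on the positive axis, an Abel
  value with the principal branch in the right half-plane, and in the whole slit plane an Abel value
  whose right-hand side is continued from the positive axis along Ln.\<close>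

theorem theorem20:
  fixes \<nu> :: real and x :: complex
  assumes "\<nu> \<ge> - 1 / 4"
    and "x \<notin> \<real>\<^sub>\<le>\<^sub>0"
  shows "(x \<in> \<real> \<longrightarrow>
            (bessel_integrand \<nu> x has_integral x / 4 * bessel_J (\<nu> - 1 / 2) (x\<^sup>2 / 4)) {0..}) \<and>
         (Re x > 0 \<longrightarrow>
            has_abel_integral (bessel_integrand \<nu> x)
              (x / 4 * bessel_J (\<nu> - 1 / 2) (x\<^sup>2 / 4))) \<and>
         has_abel_integral (bessel_integrand \<nu> x)
           (x / 4 * bessel_J_log (\<nu> - 1 / 2) (2 * Ln (x / 2)))"
proof -
  have "x \<noteq> 0" using assms(2) by auto
  with assms(1) have log: "has_abel_integral (bessel_integrand \<nu> x) (x / 4 * bessel_J_log (\<nu> - 1 / 2) (2 * Ln (x / 2)))"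
    by (rule has_abel_integral_bessel_integrand)
  then have right: "has_abel_integral (bessel_integrand \<nu> x) (x / 4 * bessel_J (\<nu> - 1 / 2) (x\<^sup>2 / 4))"
    if "Re x > 0"
    using bessel_J_log_square[OF that] by simp
  have "(bessel_integrand \<nu> x has_integral x / 4 * bessel_J (\<nu> - 1 / 2) (x\<^sup>2 / 4)) {0..}" if real: "x \<in> \<real>"
  proof -
    obtain t where t: "x = of_real t" using real unfolding Reals_def by blast
    then have "t > 0" using assms(2) by (auto simp: not_le)
    then show ?thesis
      using has_integral_bessel_integrand_of_real[OF assms(1)] right t by simp
  qed
  with log right show ?thesis by blast
qed

end
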